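(* For all $n\ge 0$, the set $\phi(\mathrm{QSV}_n)$ is a basis for the Temperley--Lieb algebra $\mathsf{TL}_n(2)$ over $\mathbb{C}$.
   Context: Write $[n] = \{1,\dots,n\}$ and let $S_n$ be the group of permutations of $[n]$, with simple transpositions $s_i = (i\ i{+}1)$. The Temperley--Lieb algebra $\mathsf{TL}_n(2)$ is the unital associative $\mathbb{C}$-algebra generated by $e_1,\dots,e_{n-1}$ subject to $e_i^2 = 2e_i$; $e_ie_j = e_je_i$ if $|i-j|>1$; and $e_ie_je_i = e_i$ if $|i-j|=1$. The map $\phi:\mathbb{C}S_n\to\mathsf{TL}_n(2)$ is the surjective algebra homomorphism determined by $\phi(s_i) = 1-e_i$. A noncrossing partition of size $n$ is a set $\lambda$ of arcs $(i,j)$, $1\le i<j\le n$, such that there are no two distinct arcs $(i,k),(j,l)\in\lambda$ with $i\le j<k\le l$. The connected components of $\lambda$ are those of the graph on $[n]$ whose edges are the arcs. The permutation $Q_\lambda\in S_n$ is defined by $Q_\lambda(j)=i$ if there is an arc $(i,j)\in\lambda$ with right endpoint $j$, and otherwise $Q_\lambda(j)$ is the largest element of the connected component of $j$. $\mathrm{QSV}_n=\{Q_\lambda:\lambda\text{ a noncrossing partition of size }n\}\subseteq S_n$. *)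

theory Defs
  imports "HOL-Algebra.Sym_Groups" "HOL-Algebra.QuotRing" "Jordan_Normal_Form.VS_Connect"
begin

text \<open>The scalar field \<open>\<complex>\<close> is the record \<open>class_ring\<close>. Algebras are \<open>module\<close> records: unlike
  the locale \<open>algebra\<close>, these do not ask for a commutative product.\<close>

text \<open>The monoid algebra \<open>\<complex>M\<close>, as finitely supported functions with the convolution product.
  For a group it is the group algebra; for the free monoid on \<open>X\<close> it is the free unital
  associative algebra on \<open>X\<close>.\<close>

definition monoid_alg :: "('m, 'k) monoid_scheme \<Rightarrow> (complex, 'm \<Rightarrow> complex) module" where
  "monoid_alg M =
    \<lparr>carrier = {f. finite {x. f x \<noteq> 0} \<and> {x. f x \<noteq> 0} \<subseteq> carrier M},
     mult = (\<lambda>f g z. \<Sum>(x, y) \<in> {(x, y). f x \<noteq> 0 \<and> g y \<noteq> 0 \<and> x \<otimes>\<^bsub>M\<^esub> y = z}. f x * g y),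
     one = (\<lambda>z. if z = \<one>\<^bsub>M\<^esub> then 1 else 0),
     zero = (\<lambda>z. 0),
     add = (\<lambda>f g z. f z + g z),
     smult = (\<lambda>c f z. c * f z)\<rparr>"

definition basis_elt :: "'m \<Rightarrow> 'm \<Rightarrow> complex" where
  "basis_elt x = (\<lambda>z. if z = x then 1 else 0)"

definition free_monoid :: "'a set \<Rightarrow> 'a list monoid" where
  "free_monoid X = \<lparr>carrier = lists X, mult = (@), one = []\<rparr>"

text \<open>The quotient by a two-sided ideal. The scalar action on cosets is written in the style of
  \<open>rcoset_mult\<close>; it satisfies \<open>c \<odot> (I + x) = I + c \<odot> x\<close>.\<close>

definition quot_alg :: "(complex, 'b) module \<Rightarrow> 'b set \<Rightarrow> (complex, 'b set) module" where
  "quot_alg A I =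
    \<lparr>carrier = carrier (A Quot I), mult = mult (A Quot I), one = one (A Quot I),
     zero = zero (A Quot I), add = add (A Quot I),
     smult = (\<lambda>c X. \<Union>x\<in>X. I +>\<^bsub>A\<^esub> (c \<odot>\<^bsub>A\<^esub> x))\<rparr>"

definition alg_hom :: "(complex, 'b) module \<Rightarrow> (complex, 'c) module \<Rightarrow> ('b \<Rightarrow> 'c) set" where
  "alg_hom A B = Ring.ring_hom A B \<inter> LinearCombinations.module_hom class_ring A B"

definition tl_free :: "nat \<Rightarrow> (complex, nat list \<Rightarrow> complex) module" where
  "tl_free n = monoid_alg (free_monoid {1..<n})"

text \<open>A relation \<open>u = v\<close> is encoded by the element \<open>u - v\<close> of the free algebra.\<close>

definition tl_rels :: "nat \<Rightarrow> complex \<Rightarrow> (nat list \<Rightarrow> complex) set" where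
  "tl_rels n \<delta> = (let F = tl_free n; e = (\<lambda>i. basis_elt [i]) in
     {e i \<otimes>\<^bsub>F\<^esub> e i \<ominus>\<^bsub>F\<^esub> \<delta> \<odot>\<^bsub>F\<^esub> e i | i. i \<in> {1..<n}}
   \<union> {e i \<otimes>\<^bsub>F\<^esub> e j \<ominus>\<^bsub>F\<^esub> e j \<otimes>\<^bsub>F\<^esub> e i | i j.
        i \<in> {1..<n} \<and> j \<in> {1..<n} \<and> \<bar>int i - int j\<bar> > 1}
   \<union> {e i \<otimes>\<^bsub>F\<^esub> e j \<otimes>\<^bsub>F\<^esub> e i \<ominus>\<^bsub>F\<^esub> e i | i j.
        i \<in> {1..<n} \<and> j \<in> {1..<n} \<and> \<bar>int i - int j\<bar> = 1})"

definition tl_ideal :: "nat \<Rightarrow> complex \<Rightarrow> (nat list \<Rightarrow> complex) set" where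
  "tl_ideal n \<delta> = Idl\<^bsub>tl_free n\<^esub> (tl_rels n \<delta>)"

definition TL :: "nat \<Rightarrow> complex \<Rightarrow> (complex, (nat list \<Rightarrow> complex) set) module" where
  "TL n \<delta> = quot_alg (tl_free n) (tl_ideal n \<delta>)"

definition tl_gen :: "nat \<Rightarrow> complex \<Rightarrow> nat \<Rightarrow> (nat list \<Rightarrow> complex) set" where
  "tl_gen n \<delta> i = tl_ideal n \<delta> +>\<^bsub>tl_free n\<^esub> basis_elt [i]"

definition noncrossing_partition :: "nat \<Rightarrow> (nat \<times> nat) set \<Rightarrow> bool" where
  "noncrossing_partition n L \<longleftrightarrow>
     L \<subseteq> {(i, j). 1 \<le> i \<and> i < j \<and> j \<le> n} \<and>
     (\<forall>(i, k) \<in> L. \<forall>(j, l) \<in> L. (i, k) \<noteq> (j, l) \<longrightarrow> \<not> (i \<le> j \<and> j < k \<and> k \<le> l))"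

definition arc_component :: "(nat \<times> nat) set \<Rightarrow> nat \<Rightarrow> nat set" where
  "arc_component L j = {k. (j, k) \<in> (L \<union> L\<inverse>)\<^sup>*}"

text \<open>The arc ending at \<open>j\<close> is unique in a noncrossing partition. Numbers outside \<open>{1..n}\<close> meet
  no arc, so they are their own components and are fixed, as \<open>permutes\<close> requires.\<close>

definition Q_perm :: "(nat \<times> nat) set \<Rightarrow> nat \<Rightarrow> nat" where
  "Q_perm L j = (if \<exists>i. (i, j) \<in> L then THE i. (i, j) \<in> L else Max (arc_component L j))"

definition QSV :: "nat \<Rightarrow> (nat \<Rightarrow> nat) set" where
  "QSV n = {Q_perm L | L. noncrossing_partition n L}"

lemma monoid_alg_mult_eq:
  assumes "finite S" "finite T" "{x. f x \<noteq> 0} \<subseteq> S" "{x. g x \<noteq> 0} \<subseteq> T"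
  shows "(f \<otimes>\<^bsub>monoid_alg M\<^esub> g) z = (\<Sum>x\<in>S. \<Sum>y\<in>T. if x \<otimes>\<^bsub>M\<^esub> y = z then f x * g y else 0)"
proof -
  have "(\<Sum>x\<in>S. \<Sum>y\<in>T. if x \<otimes>\<^bsub>M\<^esub> y = z then f x * g y else 0)
      = (\<Sum>p\<in>S \<times> T. if fst p \<otimes>\<^bsub>M\<^esub> snd p = z then f (fst p) * g (snd p) else 0)"
    by (simp add: sum.cartesian_product case_prod_beta)
  also have "\<dots> = (\<Sum>(x, y) \<in> {(x, y). f x \<noteq> 0 \<and> g y \<noteq> 0 \<and> x \<otimes>\<^bsub>M\<^esub> y = z}. f x * g y)"
    using assms by (intro sum.mono_neutral_cong_right) auto
  finally show ?thesis by (simp add: monoid_alg_def)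
qed

lemma monoid_alg_mult_closed:
  assumes "monoid M" "f \<in> carrier (monoid_alg M)" "g \<in> carrier (monoid_alg M)"
  shows "f \<otimes>\<^bsub>monoid_alg M\<^esub> g \<in> carrier (monoid_alg M)"
proof -
  let ?S = "{x. f x \<noteq> 0}" and ?T = "{x. g x \<noteq> 0}"
  have fin: "finite ?S" "finite ?T" and sub: "?S \<subseteq> carrier M" "?T \<subseteq> carrier M"
    using assms by (auto simp: monoid_alg_def)
  have "{z. (f \<otimes>\<^bsub>monoid_alg M\<^esub> g) z \<noteq> 0} \<subseteq> (\<lambda>(x, y). x \<otimes>\<^bsub>M\<^esub> y) ` (?S \<times> ?T)"
  proof
    fix z assume "z \<in> {z. (f \<otimes>\<^bsub>monoid_alg M\<^esub> g) z \<noteq> 0}"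
    then have "(\<Sum>(x, y) \<in> {(x, y). f x \<noteq> 0 \<and> g y \<noteq> 0 \<and> x \<otimes>\<^bsub>M\<^esub> y = z}. f x * g y) \<noteq> 0"
      by (simp add: monoid_alg_def)
    then obtain p where "p \<in> {(x, y). f x \<noteq> 0 \<and> g y \<noteq> 0 \<and> x \<otimes>\<^bsub>M\<^esub> y = z}"
      using sum.not_neutral_contains_not_neutral by blast
    then show "z \<in> (\<lambda>(x, y). x \<otimes>\<^bsub>M\<^esub> y) ` (?S \<times> ?T)" by force
  qed
  moreover have "(\<lambda>(x, y). x \<otimes>\<^bsub>M\<^esub> y) ` (?S \<times> ?T) \<subseteq> carrier M"
    using sub monoid.m_closed[OF assms(1)] by auto
  ultimately show ?thesis
    using fin finite_subset[OF _ finite_imageI[OF finite_cartesian_product[OF fin]]]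
    by (auto simp: monoid_alg_def)
qed

lemma monoid_alg_mult_assoc:
  assumes "monoid M" "f \<in> carrier (monoid_alg M)" "g \<in> carrier (monoid_alg M)"
    "h \<in> carrier (monoid_alg M)"
  shows "(f \<otimes>\<^bsub>monoid_alg M\<^esub> g) \<otimes>\<^bsub>monoid_alg M\<^esub> h = f \<otimes>\<^bsub>monoid_alg M\<^esub> (g \<otimes>\<^bsub>monoid_alg M\<^esub> h)"
proof
  fix z
  let ?A = "monoid_alg M"
  define S T U where "S = {x. f x \<noteq> 0}" and "T = {x. g x \<noteq> 0}" and "U = {x. h x \<noteq> 0}"
  have fin: "finite S" "finite T" "finite U"
    and sub: "S \<subseteq> carrier M" "T \<subseteq> carrier M" "U \<subseteq> carrier M"
    using assms by (auto simp: monoid_alg_def S_def T_def U_def)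
  define V where "V = {x. (f \<otimes>\<^bsub>?A\<^esub> g) x \<noteq> 0} \<union> (\<lambda>(x, y). x \<otimes>\<^bsub>M\<^esub> y) ` (S \<times> T)"
  define W where "W = {x. (g \<otimes>\<^bsub>?A\<^esub> h) x \<noteq> 0} \<union> (\<lambda>(x, y). x \<otimes>\<^bsub>M\<^esub> y) ` (T \<times> U)"
  have finV: "finite V" and finW: "finite W"
    using monoid_alg_mult_closed[OF assms(1-3)] monoid_alg_mult_closed[OF assms(1,3,4)] fin
    by (auto simp: V_def W_def monoid_alg_def)
  have l: "(f \<otimes>\<^bsub>?A\<^esub> g) w = (\<Sum>x\<in>S. \<Sum>y\<in>T. if x \<otimes>\<^bsub>M\<^esub> y = w then f x * g y else 0)" for w
    by (rule monoid_alg_mult_eq) (use fin in \<open>auto simp: S_def T_def\<close>)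
  have r: "(g \<otimes>\<^bsub>?A\<^esub> h) w = (\<Sum>x\<in>T. \<Sum>y\<in>U. if x \<otimes>\<^bsub>M\<^esub> y = w then g x * h y else 0)" for w
    by (rule monoid_alg_mult_eq) (use fin in \<open>auto simp: T_def U_def\<close>)
  have "((f \<otimes>\<^bsub>?A\<^esub> g) \<otimes>\<^bsub>?A\<^esub> h) z
      = (\<Sum>w\<in>V. \<Sum>u\<in>U. if w \<otimes>\<^bsub>M\<^esub> u = z then (f \<otimes>\<^bsub>?A\<^esub> g) w * h u else 0)"
    by (rule monoid_alg_mult_eq) (use fin finV in \<open>auto simp: V_def U_def\<close>)
  also have "\<dots> = (\<Sum>w\<in>V. \<Sum>u\<in>U. \<Sum>x\<in>S. \<Sum>y\<in>T.
      if x \<otimes>\<^bsub>M\<^esub> y = w then if w \<otimes>\<^bsub>M\<^esub> u = z then f x * g y * h u else 0 else 0)"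
    unfolding l by (intro sum.cong refl) (auto simp: sum_distrib_right intro!: sum.cong)
  also have "\<dots> = (\<Sum>u\<in>U. \<Sum>w\<in>V. \<Sum>x\<in>S. \<Sum>y\<in>T.
      if x \<otimes>\<^bsub>M\<^esub> y = w then if w \<otimes>\<^bsub>M\<^esub> u = z then f x * g y * h u else 0 else 0)"
    by (rule sum.swap)
  also have "\<dots> = (\<Sum>u\<in>U. \<Sum>x\<in>S. \<Sum>w\<in>V. \<Sum>y\<in>T.
      if x \<otimes>\<^bsub>M\<^esub> y = w then if w \<otimes>\<^bsub>M\<^esub> u = z then f x * g y * h u else 0 else 0)"
    by (intro sum.cong refl sum.swap)
  also have "\<dots> = (\<Sum>u\<in>U. \<Sum>x\<in>S. \<Sum>y\<in>T. \<Sum>w\<in>V.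
      if x \<otimes>\<^bsub>M\<^esub> y = w then if w \<otimes>\<^bsub>M\<^esub> u = z then f x * g y * h u else 0 else 0)"
    by (intro sum.cong refl sum.swap)
  also have "\<dots> = (\<Sum>u\<in>U. \<Sum>x\<in>S. \<Sum>y\<in>T. if (x \<otimes>\<^bsub>M\<^esub> y) \<otimes>\<^bsub>M\<^esub> u = z then f x * g y * h u else 0)"
    using finV by (intro sum.cong refl) (auto simp: V_def sum.delta')
  also have "\<dots> = (\<Sum>x\<in>S. \<Sum>u\<in>U. \<Sum>y\<in>T. if (x \<otimes>\<^bsub>M\<^esub> y) \<otimes>\<^bsub>M\<^esub> u = z then f x * g y * h u else 0)"
    by (rule sum.swap)
  also have "\<dots> = (\<Sum>x\<in>S. \<Sum>y\<in>T. \<Sum>u\<in>U. if (x \<otimes>\<^bsub>M\<^esub> y) \<otimes>\<^bsub>M\<^esub> u = z then f x * g y * h u else 0)"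
    by (intro sum.cong refl sum.swap)
  also have "\<dots> = (\<Sum>x\<in>S. \<Sum>y\<in>T. \<Sum>u\<in>U. if x \<otimes>\<^bsub>M\<^esub> (y \<otimes>\<^bsub>M\<^esub> u) = z then f x * (g y * h u) else 0)"
    using sub by (intro sum.cong refl) (auto simp: monoid.m_assoc[OF assms(1)] subset_iff)
  also have "\<dots> = (\<Sum>x\<in>S. \<Sum>y\<in>T. \<Sum>u\<in>U. \<Sum>w\<in>W.
      if y \<otimes>\<^bsub>M\<^esub> u = w then if x \<otimes>\<^bsub>M\<^esub> w = z then f x * (g y * h u) else 0 else 0)"
    using finW by (intro sum.cong refl) (auto simp: W_def sum.delta')
  also have "\<dots> = (\<Sum>x\<in>S. \<Sum>y\<in>T. \<Sum>w\<in>W. \<Sum>u\<in>U.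
      if y \<otimes>\<^bsub>M\<^esub> u = w then if x \<otimes>\<^bsub>M\<^esub> w = z then f x * (g y * h u) else 0 else 0)"
    by (intro sum.cong refl sum.swap)
  also have "\<dots> = (\<Sum>x\<in>S. \<Sum>w\<in>W. \<Sum>y\<in>T. \<Sum>u\<in>U.
      if y \<otimes>\<^bsub>M\<^esub> u = w then if x \<otimes>\<^bsub>M\<^esub> w = z then f x * (g y * h u) else 0 else 0)"
    by (intro sum.cong refl sum.swap)
  also have "\<dots> = (\<Sum>x\<in>S. \<Sum>w\<in>W. if x \<otimes>\<^bsub>M\<^esub> w = z then f x * (g \<otimes>\<^bsub>?A\<^esub> h) w else 0)"
    unfolding r by (intro sum.cong refl) (auto simp: sum_distrib_left intro!: sum.cong)
  also have "\<dots> = (f \<otimes>\<^bsub>?A\<^esub> (g \<otimes>\<^bsub>?A\<^esub> h)) z"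
    by (rule monoid_alg_mult_eq[symmetric]) (use fin finW in \<open>auto simp: W_def S_def\<close>)
  finally show "((f \<otimes>\<^bsub>?A\<^esub> g) \<otimes>\<^bsub>?A\<^esub> h) z = (f \<otimes>\<^bsub>?A\<^esub> (g \<otimes>\<^bsub>?A\<^esub> h)) z" .
qed

lemma ring_monoid_alg:
  assumes M: "monoid M"
  shows "ring (monoid_alg M)"
proof -
  let ?A = "monoid_alg M"
  have supp: "finite {x. f x \<noteq> 0}" if "f \<in> carrier ?A" for f
    using that by (auto simp: monoid_alg_def)
  have add_closed: "f \<oplus>\<^bsub>?A\<^esub> g \<in> carrier ?A" if "f \<in> carrier ?A" "g \<in> carrier ?A" for f g
    using that finite_subset[of "{x. f x + g x \<noteq> 0}" "{x. f x \<noteq> 0} \<union> {x. g x \<noteq> 0}"]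
    by (force simp: monoid_alg_def)
  have one: "\<one>\<^bsub>?A\<^esub> \<in> carrier ?A"
    using monoid.one_closed[OF M] by (auto simp: monoid_alg_def)
  show ?thesis
  proof (rule ringI)
    show "abelian_group ?A"
    proof (rule abelian_groupI)
      fix f assume f: "f \<in> carrier ?A"
      then have "(\<lambda>x. - f x) \<in> carrier ?A" "(\<lambda>x. - f x) \<oplus>\<^bsub>?A\<^esub> f = \<zero>\<^bsub>?A\<^esub>"
        by (auto simp: monoid_alg_def)
      then show "\<exists>g\<in>carrier ?A. g \<oplus>\<^bsub>?A\<^esub> f = \<zero>\<^bsub>?A\<^esub>" by blast
    qed (use add_closed in \<open>auto simp: monoid_alg_def algebra_simps\<close>)
    show "monoid ?A"
    proof (rule monoidI)
      fix f assume f: "f \<in> carrier ?A"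
      have sub: "{x. f x \<noteq> 0} \<subseteq> carrier M" using f by (auto simp: monoid_alg_def)
      show "\<one>\<^bsub>?A\<^esub> \<otimes>\<^bsub>?A\<^esub> f = f"
      proof
        fix z
        have "(\<one>\<^bsub>?A\<^esub> \<otimes>\<^bsub>?A\<^esub> f) z = (\<Sum>x\<in>{\<one>\<^bsub>M\<^esub>}. \<Sum>y\<in>{x. f x \<noteq> 0}.
            if x \<otimes>\<^bsub>M\<^esub> y = z then \<one>\<^bsub>?A\<^esub> x * f y else 0)"
          by (rule monoid_alg_mult_eq) (use supp[OF f] in \<open>auto simp: monoid_alg_def\<close>)
        also have "\<dots> = (\<Sum>y\<in>{x. f x \<noteq> 0}. if y = z then f y else 0)"
          using sub by (auto intro!: sum.cong simp: monoid_alg_def monoid.l_one[OF M])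
        also have "\<dots> = f z" using supp[OF f] by (simp add: sum.delta)
        finally show "(\<one>\<^bsub>?A\<^esub> \<otimes>\<^bsub>?A\<^esub> f) z = f z" .
      qed
      show "f \<otimes>\<^bsub>?A\<^esub> \<one>\<^bsub>?A\<^esub> = f"
      proof
        fix z
        have "(f \<otimes>\<^bsub>?A\<^esub> \<one>\<^bsub>?A\<^esub>) z = (\<Sum>x\<in>{x. f x \<noteq> 0}. \<Sum>y\<in>{\<one>\<^bsub>M\<^esub>}.
            if x \<otimes>\<^bsub>M\<^esub> y = z then f x * \<one>\<^bsub>?A\<^esub> y else 0)"
          by (rule monoid_alg_mult_eq) (use supp[OF f] in \<open>auto simp: monoid_alg_def\<close>)
        also have "\<dots> = (\<Sum>y\<in>{x. f x \<noteq> 0}. if y = z then f y else 0)"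
          using sub by (auto intro!: sum.cong simp: monoid_alg_def monoid.r_one[OF M])
        also have "\<dots> = f z" using supp[OF f] by (simp add: sum.delta)
        finally show "(f \<otimes>\<^bsub>?A\<^esub> \<one>\<^bsub>?A\<^esub>) z = f z" .
      qed
    qed (use one monoid_alg_mult_closed[OF M] monoid_alg_mult_assoc[OF M] in auto)
  next
    fix f g h assume fgh: "f \<in> carrier ?A" "g \<in> carrier ?A" "h \<in> carrier ?A"
    let ?S = "{x. f x \<noteq> 0} \<union> {x. g x \<noteq> 0}" and ?U = "{x. h x \<noteq> 0}"
    have fin: "finite ?S" "finite ?U" using fgh supp by auto
    have add: "(p \<oplus>\<^bsub>?A\<^esub> q) z = p z + q z" for p q z by (simp add: monoid_alg_def)
    have fg: "{x. (f \<oplus>\<^bsub>?A\<^esub> g) x \<noteq> 0} \<subseteq> ?S" by (auto simp: add)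
    note eqs = monoid_alg_mult_eq[where M = M, OF fin(1) fin(2)]
      monoid_alg_mult_eq[where M = M, OF fin(2) fin(1)]
    show "(f \<oplus>\<^bsub>?A\<^esub> g) \<otimes>\<^bsub>?A\<^esub> h = f \<otimes>\<^bsub>?A\<^esub> h \<oplus>\<^bsub>?A\<^esub> g \<otimes>\<^bsub>?A\<^esub> h"
    proof
      fix z
      have "((f \<oplus>\<^bsub>?A\<^esub> g) \<otimes>\<^bsub>?A\<^esub> h) z
          = (\<Sum>x\<in>?S. \<Sum>y\<in>?U. if x \<otimes>\<^bsub>M\<^esub> y = z then (f \<oplus>\<^bsub>?A\<^esub> g) x * h y else 0)"
        by (rule eqs(1)[OF fg order_refl])
      also have "\<dots> = (\<Sum>x\<in>?S. \<Sum>y\<in>?U. (if x \<otimes>\<^bsub>M\<^esub> y = z then f x * h y else 0)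
          + (if x \<otimes>\<^bsub>M\<^esub> y = z then g x * h y else 0))"
        by (intro sum.cong refl) (simp add: add distrib_right)
      also have "\<dots> = (f \<otimes>\<^bsub>?A\<^esub> h) z + (g \<otimes>\<^bsub>?A\<^esub> h) z"
        unfolding sum.distrib
        by (subst (1 2) eqs(1)) auto
      finally show "((f \<oplus>\<^bsub>?A\<^esub> g) \<otimes>\<^bsub>?A\<^esub> h) z = (f \<otimes>\<^bsub>?A\<^esub> h \<oplus>\<^bsub>?A\<^esub> g \<otimes>\<^bsub>?A\<^esub> h) z"
        by (simp only: add)
    qed
    show "h \<otimes>\<^bsub>?A\<^esub> (f \<oplus>\<^bsub>?A\<^esub> g) = h \<otimes>\<^bsub>?A\<^esub> f \<oplus>\<^bsub>?A\<^esub> h \<otimes>\<^bsub>?A\<^esub> g"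
    proof
      fix z
      have "(h \<otimes>\<^bsub>?A\<^esub> (f \<oplus>\<^bsub>?A\<^esub> g)) z
          = (\<Sum>x\<in>?U. \<Sum>y\<in>?S. if x \<otimes>\<^bsub>M\<^esub> y = z then h x * (f \<oplus>\<^bsub>?A\<^esub> g) y else 0)"
        by (rule eqs(2)[OF order_refl fg])
      also have "\<dots> = (\<Sum>x\<in>?U. \<Sum>y\<in>?S. (if x \<otimes>\<^bsub>M\<^esub> y = z then h x * f y else 0)
          + (if x \<otimes>\<^bsub>M\<^esub> y = z then h x * g y else 0))"
        by (intro sum.cong refl) (simp add: add distrib_left)
      also have "\<dots> = (h \<otimes>\<^bsub>?A\<^esub> f) z + (h \<otimes>\<^bsub>?A\<^esub> g) z"
        unfolding sum.distrib
        by (subst (1 2) eqs(2)) auto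
      finally show "(h \<otimes>\<^bsub>?A\<^esub> (f \<oplus>\<^bsub>?A\<^esub> g)) z = (h \<otimes>\<^bsub>?A\<^esub> f \<oplus>\<^bsub>?A\<^esub> h \<otimes>\<^bsub>?A\<^esub> g) z"
        by (simp only: add)
    qed
  qed
qed

lemma monoid_free_monoid: "monoid (free_monoid X)"
  by (rule monoidI) (auto simp: free_monoid_def)

lemma monoid_alg_smult_closed:
  assumes "f \<in> carrier (monoid_alg M)"
  shows "c \<odot>\<^bsub>monoid_alg M\<^esub> f \<in> carrier (monoid_alg M)"
  using assms finite_subset[of "{x. c * f x \<noteq> 0}" "{x. f x \<noteq> 0}"]
  by (auto simp: monoid_alg_def)

lemma monoid_alg_smult_eq_mult:
  assumes M: "monoid M" and f: "f \<in> carrier (monoid_alg M)"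
  shows "c \<odot>\<^bsub>monoid_alg M\<^esub> f = (c \<odot>\<^bsub>monoid_alg M\<^esub> \<one>\<^bsub>monoid_alg M\<^esub>) \<otimes>\<^bsub>monoid_alg M\<^esub> f"
proof
  fix z
  let ?A = "monoid_alg M"
  have fin: "finite {x. f x \<noteq> 0}" and sub: "{x. f x \<noteq> 0} \<subseteq> carrier M"
    using f by (auto simp: monoid_alg_def)
  have "((c \<odot>\<^bsub>?A\<^esub> \<one>\<^bsub>?A\<^esub>) \<otimes>\<^bsub>?A\<^esub> f) z = (\<Sum>x\<in>{\<one>\<^bsub>M\<^esub>}. \<Sum>y\<in>{x. f x \<noteq> 0}.
      if x \<otimes>\<^bsub>M\<^esub> y = z then (c \<odot>\<^bsub>?A\<^esub> \<one>\<^bsub>?A\<^esub>) x * f y else 0)"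
    by (rule monoid_alg_mult_eq) (use fin in \<open>auto simp: monoid_alg_def\<close>)
  also have "\<dots> = (\<Sum>y\<in>{x. f x \<noteq> 0}. if y = z then c * f y else 0)"
    using sub by (auto intro!: sum.cong simp: monoid_alg_def monoid.l_one[OF M])
  also have "\<dots> = (c \<odot>\<^bsub>?A\<^esub> f) z" using fin by (simp add: sum.delta monoid_alg_def)
  finally show "(c \<odot>\<^bsub>?A\<^esub> f) z = ((c \<odot>\<^bsub>?A\<^esub> \<one>\<^bsub>?A\<^esub>) \<otimes>\<^bsub>?A\<^esub> f) z" ..
qed

lemma quot_alg_smult:
  assumes M: "monoid M" and I: "ideal I (monoid_alg M)" and x: "x \<in> carrier (monoid_alg M)"
  shows "c \<odot>\<^bsub>quot_alg (monoid_alg M) I\<^esub> (I +>\<^bsub>monoid_alg M\<^esub> x)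
       = I +>\<^bsub>monoid_alg M\<^esub> (c \<odot>\<^bsub>monoid_alg M\<^esub> x)"
proof -
  let ?A = "monoid_alg M"
  interpret I: ideal I ?A by (rule I)
  have "I +>\<^bsub>?A\<^esub> (c \<odot>\<^bsub>?A\<^esub> y) = I +>\<^bsub>?A\<^esub> (c \<odot>\<^bsub>?A\<^esub> x)" if y: "y \<in> I +>\<^bsub>?A\<^esub> x" for y
  proof -
    obtain a where a: "a \<in> I" "y = a \<oplus>\<^bsub>?A\<^esub> x" using y by (auto simp: a_r_coset_def')
    have "c \<odot>\<^bsub>?A\<^esub> a \<in> I"
      using a monoid_alg_smult_eq_mult[OF M I.a_Hcarr[OF a(1)]]
        I.I_l_closed monoid_alg_smult_closed[OF I.one_closed] by metis
    moreover have "c \<odot>\<^bsub>?A\<^esub> y = c \<odot>\<^bsub>?A\<^esub> a \<oplus>\<^bsub>?A\<^esub> c \<odot>\<^bsub>?A\<^esub> x"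
      by (simp add: a monoid_alg_def algebra_simps)
    ultimately have "c \<odot>\<^bsub>?A\<^esub> y \<in> I +>\<^bsub>?A\<^esub> (c \<odot>\<^bsub>?A\<^esub> x)" by (auto simp: a_r_coset_def')
    then show ?thesis
      using I.a_repr_independence' monoid_alg_smult_closed[OF x] by blast
  qed
  moreover have "x \<in> I +>\<^bsub>?A\<^esub> x" using I.a_rcos_self[OF x] by simp
  ultimately have "(\<Union>y\<in>I +>\<^bsub>?A\<^esub> x. I +>\<^bsub>?A\<^esub> (c \<odot>\<^bsub>?A\<^esub> y)) = I +>\<^bsub>?A\<^esub> (c \<odot>\<^bsub>?A\<^esub> x)"
    by blast
  then show ?thesis by (simp add: quot_alg_def)
qed

lemma vectorspace_quot_monoid_alg:
  assumes M: "monoid M" and I: "ideal I (monoid_alg M)"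
  shows "vectorspace class_ring (quot_alg (monoid_alg M) I)"
proof -
  let ?A = "monoid_alg M" and ?B = "quot_alg (monoid_alg M) I"
  interpret I: ideal I ?A by (rule I)
  interpret Q: ring "?A Quot I" by (rule I.quotient_is_ring)
  have car: "carrier ?B = carrier (?A Quot I)" and add: "add ?B = add (?A Quot I)"
    and zero: "zero ?B = zero (?A Quot I)"
    by (auto simp: quot_alg_def)
  have rep: "\<exists>x\<in>carrier ?A. X = I +>\<^bsub>?A\<^esub> x" if "X \<in> carrier ?B" for X
    using that by (auto simp: car FactRing_def A_RCOSETS_def')
  have plus: "(I +>\<^bsub>?A\<^esub> x) \<oplus>\<^bsub>?B\<^esub> (I +>\<^bsub>?A\<^esub> y) = I +>\<^bsub>?A\<^esub> (x \<oplus>\<^bsub>?A\<^esub> y)"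
    if "x \<in> carrier ?A" "y \<in> carrier ?A" for x y
    using that by (simp add: quot_alg_def FactRing_def I.a_rcos_sum)
  have ab: "abelian_group ?B"
    by (rule abelian_groupI)
      (auto simp: car add zero Q.add.m_ac intro: Q.l_neg Q.a_inv_closed)
  note smult = quot_alg_smult[OF M I] and sc = monoid_alg_smult_closed
  have "module class_ring ?B"
  proof (rule Module.module.intro)
    show "cring (class_ring :: complex ring)" by unfold_locales
    show "abelian_group ?B" by (rule ab)
    show "module_axioms class_ring ?B"
    proof (rule Module.module_axioms.intro)
      fix a b :: complex and X Y assume X: "X \<in> carrier ?B" and Y: "Y \<in> carrier ?B"
      obtain x y where x: "x \<in> carrier ?A" "X = I +>\<^bsub>?A\<^esub> x" and y: "y \<in> carrier ?A" "Y = I +>\<^bsub>?A\<^esub> y"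
        using rep X Y by blast
      show "a \<odot>\<^bsub>?B\<^esub> (X \<oplus>\<^bsub>?B\<^esub> Y) = a \<odot>\<^bsub>?B\<^esub> X \<oplus>\<^bsub>?B\<^esub> a \<odot>\<^bsub>?B\<^esub> Y"
        using x y by (simp add: plus smult sc) (simp add: monoid_alg_def algebra_simps)
    next
      fix a b :: complex and X assume X: "X \<in> carrier ?B"
      obtain x where x: "x \<in> carrier ?A" "X = I +>\<^bsub>?A\<^esub> x" using rep X by blast
      show "a \<odot>\<^bsub>?B\<^esub> X \<in> carrier ?B"
        using x sc[OF x(1)] by (auto simp: smult car FactRing_def A_RCOSETS_def')
      show "(a \<oplus>\<^bsub>class_ring\<^esub> b) \<odot>\<^bsub>?B\<^esub> X = a \<odot>\<^bsub>?B\<^esub> X \<oplus>\<^bsub>?B\<^esub> b \<odot>\<^bsub>?B\<^esub> X"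
        using x by (simp add: plus smult sc) (simp add: monoid_alg_def algebra_simps)
      show "(a \<otimes>\<^bsub>class_ring\<^esub> b) \<odot>\<^bsub>?B\<^esub> X = a \<odot>\<^bsub>?B\<^esub> (b \<odot>\<^bsub>?B\<^esub> X)"
        using x by (simp add: smult sc) (simp add: monoid_alg_def algebra_simps)
      show "\<one>\<^bsub>class_ring\<^esub> \<odot>\<^bsub>?B\<^esub> X = X"
        using x by (simp add: smult sc) (simp add: monoid_alg_def)
    qed
  qed
  moreover have "field (class_ring :: complex ring)" by unfold_locales
  ultimately show ?thesis by (rule vectorspace.intro)
qed

lemma tl_rels_subset: "tl_rels n \<delta> \<subseteq> carrier (tl_free n)"
proof -
  interpret F: ring "tl_free n"
    unfolding tl_free_def by (rule ring_monoid_alg[OF monoid_free_monoid])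
  have "basis_elt [i] \<in> carrier (tl_free n)" if "i \<in> {1..<n}" for i
    using that by (auto simp: tl_free_def monoid_alg_def free_monoid_def basis_elt_def)
  moreover have "c \<odot>\<^bsub>tl_free n\<^esub> f \<in> carrier (tl_free n)" if "f \<in> carrier (tl_free n)" for c f
    using that monoid_alg_smult_closed unfolding tl_free_def by blast
  ultimately show ?thesis
    unfolding tl_rels_def Let_def by (blast intro: F.minus_closed F.m_closed)
qed

lemma ideal_tl_ideal: "ideal (tl_ideal n \<delta>) (tl_free n)"
  unfolding tl_ideal_def
  by (intro ring.genideal_ideal tl_rels_subset)
    (simp add: tl_free_def ring_monoid_alg monoid_free_monoid)

lemma vectorspace_TL: "vectorspace class_ring (TL n \<delta>)"
  using vectorspace_quot_monoid_alg[OF monoid_free_monoid ideal_tl_ideal[unfolded tl_free_def]]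
  by (simp add: TL_def tl_free_def)

end

theory Submission
  imports Defs
begin

text \<open>The symmetric group acts on functions of subsets of \<open>{1..n}\<close>, and letting \<open>e\<^sub>i\<close> act as \<open>1 - s\<^sub>i\<close>
  gives a representation of the Temperley--Lieb algebra. Let \<open>L\<^sub>\<lambda>\<close> and \<open>R\<^sub>\<lambda>\<close> be the sets of left and of
  right endpoints of \<open>\<lambda>\<close>. The matrix entries at the pairs \<open>(R\<^sub>\<lambda>, L\<^sub>\<lambda>)\<close> are unitriangular: if \<open>Q\<^sub>\<mu>\<close>
  maps \<open>R\<^sub>\<lambda>\<close> onto \<open>L\<^sub>\<lambda>\<close> then \<open>\<mu> = \<lambda>\<close>, or \<open>\<mu>\<close> has larger weight, where the weight is twice the total
  arc length minus the number of arcs. Hence the images of the \<open>Q\<^sub>\<lambda>\<close> are linearly independent.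

  The relation \<open>e\<^sub>i e\<^sub>j e\<^sub>i = e\<^sub>i\<close> says that the antisymmetrizer of three adjacent letters vanishes, and
  by conjugation so does that of any three letters. It rewrites a permutation containing the pattern
  321 in terms of permutations \<open>p\<close> with larger \<open>\<Sum>j. j * p j\<close>, so the 321-avoiding permutations span. Such
  a permutation is determined by its set \<open>{j. p j < j}\<close> of positions and by the values there, and
  these are the right and left endpoints of some noncrossing partition. So there are at most as many of
  them as noncrossing partitions, and a dimension count finishes the proof.\<close>

section \<open>Noncrossing partitions and 321-avoiding permutations\<close>

text \<open>Rearrangement inequality: undoing an inversion raises the sum by
  \<open>(b - a) * (f a - f b)\<close>. This measures both the uncrossing of arcs and the rewriting
  of permutations that contain 321.\<close>

lemma sum_mult_swap_less:
  fixes f :: "nat \<Rightarrow> nat"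
  assumes "finite A" "a \<in> A" "b \<in> A" "a < b" "f b < f a"
  shows "(\<Sum>j\<in>A. j * f j) < (\<Sum>j\<in>A. j * (f \<circ> transpose a b) j)"
proof -
  let ?B = "A - {a} - {b}"
  have split: "(\<Sum>j\<in>A. g j) = g a + (g b + (\<Sum>j\<in>?B. g j))" for g :: "nat \<Rightarrow> nat"
    using assms by (simp add: sum.remove)
  have eq: "(\<Sum>j\<in>?B. j * (f \<circ> transpose a b) j) = (\<Sum>j\<in>?B. j * f j)"
    by (intro sum.cong) auto
  \<comment> \<open>Writing both gaps as successors avoids truncated subtraction.\<close>
  obtain c d where "b = a + Suc c" "f a = f b + Suc d"
    using assms less_imp_Suc_add by (metis add_Suc_right)
  then have "a * f a + b * f b < a * f b + b * f a"
    by (simp add: algebra_simps)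
  then show ?thesis
    by (subst (1 2) split, subst eq) simp
qed

section \<open>Noncrossing partitions and their endpoints\<close>

lemma finite_noncrossing: "noncrossing_partition n L \<Longrightarrow> finite L"
  by (rule finite_subset[of _ "{..n} \<times> {..n}"]) (auto simp: noncrossing_partition_def)

lemma noncrossingD:
  assumes "noncrossing_partition n L" "(i, j) \<in> L"
  shows "1 \<le> i" "i < j" "j \<le> n"
  using assms by (auto simp: noncrossing_partition_def)

lemma noncrossing_no_cross:
  assumes "noncrossing_partition n L" "(i, k) \<in> L" "(j, l) \<in> L" "i \<le> j" "j < k" "k \<le> l"
  shows "i = j" "k = l"
proof -
  have "\<forall>x\<in>L. \<forall>y\<in>L. x \<noteq> y \<longrightarrow> \<not> (fst x \<le> fst y \<and> fst y < snd x \<and> snd x \<le> snd y)"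
    using assms(1) unfolding noncrossing_partition_def case_prod_beta prod.collapse by (rule conjunct2)
  from bspec[OF bspec[OF this assms(2)] assms(3)] assms(4-6)
  show "i = j" "k = l" by auto
qed

text \<open>Because the inequalities in the noncrossing condition are weak, two distinct arcs with
  the same right endpoint already count as crossing.\<close>

lemma noncrossing_left_unique:
  assumes "noncrossing_partition n L" "(i, k) \<in> L" "(j, k) \<in> L"
  shows "i = j"
  using noncrossing_no_cross[OF assms(1,2,3)] noncrossing_no_cross[OF assms(1,3,2)]
    noncrossingD[OF assms(1,2)] noncrossingD[OF assms(1,3)] by (metis linear order_refl)

lemma noncrossing_right_unique:
  assumes "noncrossing_partition n L" "(i, k) \<in> L" "(i, l) \<in> L"
  shows "k = l"
  using noncrossing_no_cross[OF assms(1,2,3)] noncrossing_no_cross[OF assms(1,3,2)]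
    noncrossingD[OF assms(1,2)] noncrossingD[OF assms(1,3)] by (metis linear order_refl)

text \<open>If \<open>l < l' < r\<close>, the arc of \<open>L\<close> that starts at
  \<open>l'\<close> must end before \<open>r\<close>. It then belongs to \<open>M\<close> as well,
  where \<open>l'\<close> would start two arcs.\<close>

lemma noncrossing_same_partner:
  assumes "noncrossing_partition n L" "noncrossing_partition n M" "Domain L = Domain M"
    and "(l, r) \<in> L" "(l', r) \<in> M"
    and less: "\<And>i j. (i, j) \<in> L \<Longrightarrow> j < r \<Longrightarrow> (i, j) \<in> M"
  shows "l' \<le> l"
proof (rule ccontr)
  assume "\<not> l' \<le> l"
  then have "l < l'" by simp
  have "l' < r" using noncrossingD assms by blast
  obtain r' where r': "(l', r') \<in> L" using assms by blast
  have "r' < r"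
    using noncrossing_no_cross(1)[OF assms(1,4) r'] \<open>l < l'\<close> \<open>l' < r\<close> by linarith
  then show False
    using less[OF r'] noncrossing_right_unique assms by blast
qed

text \<open>As with parentheses, the positions of the endpoints determine the matching. The arcs are
  recovered in order of their right endpoints, comparing left partners in both directions.\<close>

lemma noncrossing_eqI:
  assumes L: "noncrossing_partition n L" and M: "noncrossing_partition n M"
    and eq: "Domain L = Domain M" "Range L = Range M"
  shows "L = M"
proof -
  have "(i, j) \<in> L \<longleftrightarrow> (i, j) \<in> M" for i j
  proof (induction j arbitrary: i rule: less_induct)
    case (less j)
    show ?case
    proof (cases "j \<in> Range L")
      case True
      then obtain l l' where l: "(l, j) \<in> L" and l': "(l', j) \<in> M" using eq by blast
      have "l = l'"
        using noncrossing_same_partner[OF L M _ l l'] noncrossing_same_partner[OF M L _ l' l]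
          less eq by (metis antisym)
      then show ?thesis
        using noncrossing_left_unique[OF L l] noncrossing_left_unique[OF M l'] l l' by blast
    next
      case False
      then show ?thesis using eq by blast
    qed
  qed
  then show ?thesis by auto
qed

section \<open>Arc components and the permutation \<open>Q_perm\<close>\<close>

lemma self_mem_arc_component: "j \<in> arc_component L j"
  by (simp add: arc_component_def)

lemma arc_component_subset:
  assumes "noncrossing_partition n L"
  shows "arc_component L j \<subseteq> insert j {1..n}"
proof
  fix k assume "k \<in> arc_component L j"
  then have "(j, k) \<in> (L \<union> L\<inverse>)\<^sup>*" by (simp add: arc_component_def)
  then show "k \<in> insert j {1..n}"
    by (cases rule: rtranclE) (use noncrossingD[OF assms] in fastforce)+
qed

lemma finite_arc_component: "noncrossing_partition n L \<Longrightarrow> finite (arc_component L j)"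
  using finite_subset[OF arc_component_subset] by blast

lemma arc_component_eq:
  assumes "k \<in> arc_component L j"
  shows "arc_component L k = arc_component L j"
proof -
  have "sym ((L \<union> L\<inverse>)\<^sup>*)" by (intro sym_rtrancl) (auto intro: symI)
  then have "(k, j) \<in> (L \<union> L\<inverse>)\<^sup>*" "(j, k) \<in> (L \<union> L\<inverse>)\<^sup>*"
    using assms by (auto simp: arc_component_def dest: symD)
  then show ?thesis by (auto simp: arc_component_def intro: rtrancl_trans)
qed

lemma Q_perm_arc:
  assumes "noncrossing_partition n L" "(i, j) \<in> L"
  shows "Q_perm L j = i"
  using assms noncrossing_left_unique[OF assms(1)] by (auto simp: Q_perm_def intro!: the_equality)

lemma Q_perm_not_Range: "j \<notin> Range L \<Longrightarrow> Q_perm L j = Max (arc_component L j)"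
  by (auto simp: Q_perm_def)

lemma Q_perm_less_iff:
  assumes "noncrossing_partition n L"
  shows "Q_perm L j < j \<longleftrightarrow> j \<in> Range L"
proof
  assume "j \<in> Range L"
  then obtain i where "(i, j) \<in> L" by blast
  then show "Q_perm L j < j" using Q_perm_arc[OF assms] noncrossingD[OF assms] by metis
next
  assume "Q_perm L j < j"
  moreover have "j \<le> Max (arc_component L j)"
    using finite_arc_component[OF assms] self_mem_arc_component by simp
  ultimately show "j \<in> Range L" using Q_perm_not_Range by (metis not_le)
qed

text \<open>An arc starting at the maximum would lead to a larger element of the component. So
  \<open>Q_perm\<close> avoids left endpoints at every point that is not a right endpoint.\<close>

lemma Max_arc_component_not_Domain:
  assumes "noncrossing_partition n L"
  shows "Max (arc_component L j) \<notin> Domain L"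
proof
  let ?m = "Max (arc_component L j)"
  assume "?m \<in> Domain L"
  then obtain k where k: "(?m, k) \<in> L" by blast
  have "?m \<in> arc_component L j"
    using finite_arc_component[OF assms] self_mem_arc_component by (intro Max_in) auto
  then have "k \<in> arc_component L j"
    using k by (auto simp: arc_component_def intro: rtrancl_into_rtrancl)
  then have "k \<le> ?m" using finite_arc_component[OF assms] by simp
  then show False using noncrossingD(2)[OF assms k] by simp
qed

text \<open>Left partners are unique, so a backward step can only undo the forward step before it. A
  path that starts outside \<open>Range L\<close> thus reduces to a forward path, and a nontrivial
  forward path ends in \<open>Range L\<close>.\<close>

lemma arc_component_no_Range:
  assumes L: "noncrossing_partition n L"
    and "j \<notin> Range L" "k \<notin> Range L" "k \<in> arc_component L j"
  shows "k = j"
proof -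
  have "(j, k) \<in> (L \<union> L\<inverse>)\<^sup>*" using assms by (simp add: arc_component_def)
  then have "(j, k) \<in> L\<^sup>*"
  proof induction
    case (step k k')
    show ?case
    proof (cases "(k, k') \<in> L")
      case False
      then have k': "(k', k) \<in> L" using step.hyps by auto
      from step.IH show ?thesis
      proof (cases rule: rtranclE)
        case base
        then show ?thesis using k' \<open>j \<notin> Range L\<close> by blast
      next
        case (step k'')
        then show ?thesis using noncrossing_left_unique[OF L k'] by blast
      qed
    qed (use step.IH in auto)
  qed auto
  then show ?thesis using \<open>k \<notin> Range L\<close> by (cases rule: rtranclE) auto
qed

text \<open>By \<open>Dom\<close>, the value reveals whether the argument is a right endpoint. If
  so, the arc is determined by its left end; if not, the value determines the component, which has
  only one point outside \<open>Range L\<close>.\<close>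

lemma inj_Q_perm:
  assumes L: "noncrossing_partition n L"
  shows "inj (Q_perm L)"
proof (rule injI)
  fix j k assume eq: "Q_perm L j = Q_perm L k"
  have Dom: "Q_perm L i \<in> Domain L \<longleftrightarrow> i \<in> Range L" for i
    using Q_perm_arc[OF L] Q_perm_not_Range Max_arc_component_not_Domain[OF L] by (metis DomainI RangeE)
  show "j = k"
  proof (cases "j \<in> Range L")
    case True
    then obtain i i' where i: "(i, j) \<in> L" "(i', k) \<in> L" using Dom eq by (metis RangeE)
    then show ?thesis using Q_perm_arc[OF L] eq noncrossing_right_unique[OF L] by metis
  next
    case False
    then have "k \<notin> Range L" using Dom eq by metis
    have "Max (arc_component L i) \<in> arc_component L i" for i
      using finite_arc_component[OF L] self_mem_arc_component by (intro Max_in) auto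
    then have "arc_component L j = arc_component L k"
      using arc_component_eq eq Q_perm_not_Range False \<open>k \<notin> Range L\<close> by metis
    then show ?thesis
      using arc_component_no_Range[OF L \<open>k \<notin> Range L\<close> False] self_mem_arc_component by metis
  qed
qed

lemma Q_perm_permutes:
  assumes L: "noncrossing_partition n L"
  shows "Q_perm L permutes {1..n}"
proof (rule bij_imp_permutes)
  have "Q_perm L j \<in> {1..n}" if "j \<in> {1..n}" for j
  proof (cases "j \<in> Range L")
    case True
    then show ?thesis using Q_perm_arc[OF L] noncrossingD[OF L] that by fastforce
  next
    case False
    have "Max (arc_component L j) \<in> arc_component L j"
      using finite_arc_component[OF L] self_mem_arc_component by (intro Max_in) auto
    then show ?thesis using False that arc_component_subset[OF L, of j] by (auto simp: Q_perm_not_Range)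
  qed
  then have "Q_perm L ` {1..n} \<subseteq> {1..n}" by blast
  moreover have "inj_on (Q_perm L) {1..n}" using inj_Q_perm[OF L] by (rule inj_on_subset) simp
  ultimately show "bij_betw (Q_perm L) {1..n} {1..n}"
    by (simp add: bij_betw_def endo_inj_surj)
next
  fix j assume j: "j \<notin> {1..n}"
  then have no: "j \<notin> Range L" "j \<notin> Domain L" using noncrossingD[OF L] by fastforce+
  have "arc_component L j = {j}"
  proof -
    have "k = j" if "(j, k) \<in> (L \<union> L\<inverse>)\<^sup>*" for k
      using that no by (induction rule: rtrancl_induct) auto
    then show ?thesis by (auto simp: arc_component_def)
  qed
  then show "Q_perm L j = j" by (simp add: Q_perm_not_Range no)
qed

lemma Q_perm_image_Range: "noncrossing_partition n L \<Longrightarrow> Q_perm L ` Range L = Domain L"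
  using Q_perm_arc by (fastforce simp: image_iff)

text \<open>Permutations act through preimages, so this form yields the diagonal entries of the
  unitriangular matrix.\<close>

lemma Q_perm_vimage_Domain:
  assumes L: "noncrossing_partition n L"
  shows "Q_perm L -` Domain L = Range L"
  using Q_perm_image_Range[OF L] inj_Q_perm[OF L] by (metis inj_vimage_image_eq)

text \<open>Twice the total length of the arcs, minus their number. As \<open>2 (j - Q j) - 1\<close> is positive when
  \<open>j\<close> is a right endpoint and negative otherwise, its sum over a set \<open>R\<close> is maximal exactly when \<open>R\<close>
  is the set of right endpoints.\<close>

definition arc_weight :: "(nat \<times> nat) set \<Rightarrow> int" where
  "arc_weight L = 2 * (\<Sum>j\<in>Range L. int j) - 2 * (\<Sum>i\<in>Domain L. int i) - int (card (Range L))"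

lemma arc_weight_mono:
  assumes L: "noncrossing_partition n L" and M: "noncrossing_partition n M"
    and pre: "Q_perm M -` Domain L = Range L"
  shows "arc_weight L < arc_weight M \<or> L = M"
proof -
  let ?Q = "Q_perm M"
  \<comment> \<open>The summand \<open>- 1\<close> makes \<open>g\<close> negative at fixed points
    too.\<close>
  define g where "g j = 2 * (int j - int (?Q j)) - 1" for j
  have fin: "finite (Range L)" "finite (Range M)"
    using finite_noncrossing L M by (auto simp: finite_Range)
  \<comment> \<open>The one function \<open>g\<close>, built from \<open>M\<close>, computes both
    weights, since \<open>?Q\<close> maps right endpoints onto left endpoints for \<open>L\<close>
    as well as for \<open>M\<close>.\<close>
  have weight: "arc_weight K = (\<Sum>j\<in>Range K. g j)"
    if "?Q ` Range K = Domain K" for K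
  proof -
    have "(\<Sum>i\<in>Domain K. int i) = (\<Sum>j\<in>Range K. int (?Q j))"
      using that inj_Q_perm[OF M] by (metis (no_types, lifting) inj_on_subset subset_UNIV sum.reindex_cong)
    then show ?thesis
      by (simp add: arc_weight_def g_def sum_subtractf sum_distrib_left)
  qed
  have img: "?Q ` Range L = Domain L"
    using pre Q_perm_permutes[OF M] by (metis permutes_surj surj_image_vimage_eq)
  have pos: "g j > 0" if "j \<in> Range M" for j
    using that Q_perm_less_iff[OF M, of j] by (auto simp: g_def)
  have neg: "g j < 0" if "j \<notin> Range M" for j
    using that Q_perm_less_iff[OF M, of j] by (auto simp: g_def)
  let ?A = "Range L" and ?B = "Range M"
  \<comment> \<open>Common right endpoints cancel; what remains has a nonnegative sum over each
    difference set.\<close>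
  have diff: "arc_weight M - arc_weight L = (\<Sum>j\<in>?B - ?A. g j) + (\<Sum>j\<in>?A - ?B. - g j)"
    using sum.Int_Diff[OF fin(1), of g ?B] sum.Int_Diff[OF fin(2), of g ?A]
    by (simp add: weight img Q_perm_image_Range[OF M] sum_negf Int_commute)
  show ?thesis
  proof (cases "?A = ?B")
    case True
    then have "Domain L = Domain M" using img Q_perm_image_Range[OF M] by simp
    then show ?thesis using noncrossing_eqI[OF L M] True by simp
  next
    case False
    have nn: "0 \<le> (\<Sum>j\<in>?B - ?A. g j)" "0 \<le> (\<Sum>j\<in>?A - ?B. - g j)"
      by (rule sum_nonneg; use pos neg in \<open>force dest: less_imp_le\<close>)+
    from False consider "?B - ?A \<noteq> {}" | "?A - ?B \<noteq> {}" by blast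
    then have "0 < (\<Sum>j\<in>?B - ?A. g j) \<or> 0 < (\<Sum>j\<in>?A - ?B. - g j)"
    proof cases
      case 1
      then show ?thesis using fin pos by (intro disjI1 sum_pos) auto
    next
      case 2
      then show ?thesis using fin neg by (intro disjI2 sum_pos) auto
    qed
    then show ?thesis using nn diff by linarith
  qed
qed

lemma finite_Collect_noncrossing: "finite {L. noncrossing_partition n L}"
  by (rule finite_subset[of _ "Pow ({..n} \<times> {..n})"]) (auto simp: noncrossing_partition_def)

text \<open>Among the bijections \<open>h\<close> with \<open>h j < j\<close>, one that minimises \<open>\<Sum>j. j * h j\<close> has no crossing
  arcs, because uncrossing two arcs lowers this sum.\<close>

lemma noncrossing_exists:
  assumes "finite A" "bij_betw f A B" "\<And>j. j \<in> A \<Longrightarrow> 1 \<le> f j \<and> f j < j \<and> j \<le> n"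
  shows "\<exists>L. noncrossing_partition n L \<and> Range L = A \<and> Domain L = B"
proof -
  define P where "P h \<longleftrightarrow> bij_betw h A B \<and> (\<forall>j\<in>A. h j < j)" for h :: "nat \<Rightarrow> nat"
  have "P f" using assms by (auto simp: P_def)
  then obtain h where h: "P h"
    and min: "\<And>h'. P h' \<Longrightarrow> (\<Sum>j\<in>A. j * h j) \<le> (\<Sum>j\<in>A. j * h' j)"
    using ex_has_least_nat[of P f "\<lambda>h. \<Sum>j\<in>A. j * h j"] by blast
  have bij: "bij_betw h A B" and less: "\<And>j. j \<in> A \<Longrightarrow> h j < j" using h by (auto simp: P_def)
  define L where "L = (\<lambda>j. (h j, j)) ` A"
  have Ran: "Range L = A" and Dom: "Domain L = B"
    using bij by (force simp: L_def bij_betw_def)+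
  have "1 \<le> i" if "i \<in> B" for i using that assms by (auto simp: bij_betw_def)
  then have sub: "L \<subseteq> {(i, j). 1 \<le> i \<and> i < j \<and> j \<le> n}"
    using less assms(3) Dom by (auto simp: L_def)
  have False if kl: "k \<in> A" "l \<in> A" "k \<noteq> l" "h k \<le> h l" "h l < k" "k \<le> l" for k l
  proof -
    have "h k \<noteq> h l" using bij kl by (metis bij_betw_imp_inj_on inj_onD)
    then have lt: "h k < h l" "k < l" using kl by auto
    \<comment> \<open>The arcs at \<open>k\<close> and \<open>l\<close> exchange left endpoints,
      turning a crossing into a nesting.\<close>
    let ?h = "h \<circ> transpose k l"
    have "bij_betw (transpose k l) A A"
      using kl by (intro permutes_imp_bij permutes_swap_id)
    then have "bij_betw ?h A B" using bij by (rule bij_betw_trans)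
    moreover have "?h j < j" if "j \<in> A" for j
      using less[OF that] lt kl by (cases "j = k"; cases "j = l") auto
    ultimately have "P ?h" by (auto simp: P_def)
    then have "(\<Sum>j\<in>A. j * h j) \<le> (\<Sum>j\<in>A. j * ?h j)" by (rule min)
    \<comment> \<open>The second swap restores \<open>h\<close>, so \<open>h\<close> would have a
      larger sum than \<open>?h\<close>.\<close>
    moreover have "(\<Sum>j\<in>A. j * ?h j) < (\<Sum>j\<in>A. j * (?h \<circ> transpose k l) j)"
      using assms(1) kl lt by (intro sum_mult_swap_less) auto
    ultimately show False by (simp add: comp_assoc)
  qed
  then have "noncrossing_partition n L"
    using sub unfolding noncrossing_partition_def by (auto simp: L_def)
  then show ?thesis using Ran Dom by blast
qed

section \<open>Permutations avoiding 321\<close>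

definition avoids_321 :: "nat \<Rightarrow> (nat \<Rightarrow> nat) \<Rightarrow> bool" where
  "avoids_321 n p \<longleftrightarrow> p permutes {1..n} \<and>
     (\<nexists>a b c. a \<in> {1..n} \<and> b \<in> {1..n} \<and> c \<in> {1..n} \<and> a < b \<and> b < c \<and> p c < p b \<and> p b < p a)"

text \<open>The positions of the strict anti-excedances; for \<open>Q_perm L\<close> they form
  \<open>Range L\<close>, by \<open>Q_perm_less_iff\<close>.\<close>

definition antiexc :: "(nat \<Rightarrow> nat) \<Rightarrow> nat set" where
  "antiexc p = {j. p j < j}"

lemma antiexc_subset: "p permutes {1..n} \<Longrightarrow> antiexc p \<subseteq> {1..n}"
  unfolding antiexc_def permutes_def by (metis (mono_tags, lifting) less_irrefl mem_Collect_eq subsetI)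

text \<open>Since \<open>p j < j\<close>, the values up to \<open>p j\<close> are too few for all
  positions before \<open>j\<close>. Some earlier position therefore has a value above
  \<open>p j\<close>, which completes an inversion \<open>j\<close>, \<open>k\<close> to a pattern
  321.\<close>

lemma avoids_321_antiexc_mono:
  assumes p: "avoids_321 n p" and jk: "j \<in> antiexc p" "k \<in> antiexc p" "j < k"
  shows "p j < p k"
proof (rule ccontr)
  have perm: "p permutes {1..n}" using p by (simp add: avoids_321_def)
  have in_n: "j \<in> {1..n}" "k \<in> {1..n}" using jk antiexc_subset[OF perm] by auto
  assume "\<not> p j < p k"
  then have kj: "p k < p j" using jk permutes_inj[OF perm] by (metis injD less_irrefl linorder_neqE_nat)
  have "\<exists>i. i \<in> {1..<j} \<and> p j < p i"
  proof (rule ccontr)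
    assume "\<not> ?thesis"
    then have "p ` ({1..<j} \<union> {j, k}) \<subseteq> {1..p j}"
      using kj permutes_in_image[OF perm] in_n by (force simp: not_less)
    moreover have "inj_on p ({1..<j} \<union> {j, k})"
      using permutes_inj[OF perm] by (rule inj_on_subset) simp
    ultimately have "card ({1..<j} \<union> {j, k}) \<le> card {1..p j}"
      by (metis card_inj_on_le finite_atLeastAtMost)
    moreover have "card ({1..<j} \<union> {j, k}) = j + 1"
      using jk in_n by (subst card_Un_disjoint) auto
    ultimately show False using jk by (simp add: antiexc_def)
  qed
  then obtain i where "i \<in> {1..n}" "i < j" "p j < p i" using in_n by auto
  then show False using p in_n kj jk unfolding avoids_321_def by blast
qed

text \<open>Dually, \<open>k \<le> p k\<close> leaves at most \<open>n - k + 1\<close> values from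
  \<open>p k\<close> on, whereas \<open>j\<close> and the positions from \<open>k\<close> on number
  \<open>n - k + 2\<close>. So some later position has a value below \<open>p k\<close>.\<close>

lemma avoids_321_not_antiexc_mono:
  assumes p: "avoids_321 n p" and jk: "j \<notin> antiexc p" "k \<notin> antiexc p" "j < k"
    and in_n: "j \<in> {1..n}" "k \<in> {1..n}"
  shows "p j < p k"
proof (rule ccontr)
  have perm: "p permutes {1..n}" using p by (simp add: avoids_321_def)
  assume "\<not> p j < p k"
  then have kj: "p k < p j" using jk permutes_inj[OF perm] by (metis injD less_irrefl linorder_neqE_nat)
  have "\<exists>i. i \<in> {k<..n} \<and> p i < p k"
  proof (rule ccontr)
    assume "\<not> ?thesis"
    then have "p ` ({k<..n} \<union> {j, k}) \<subseteq> {p k..n}"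
      using kj permutes_in_image[OF perm] in_n by (force simp: not_less)
    moreover have "inj_on p ({k<..n} \<union> {j, k})"
      using permutes_inj[OF perm] by (rule inj_on_subset) simp
    ultimately have "card ({k<..n} \<union> {j, k}) \<le> card {p k..n}"
      by (metis card_inj_on_le finite_atLeastAtMost)
    moreover have "card ({k<..n} \<union> {j, k}) = n - k + 2"
      using jk in_n by (subst card_Un_disjoint) auto
    ultimately show False using jk in_n by (simp add: antiexc_def)
  qed
  then obtain i where "i \<in> {1..n}" "k < i" "p i < p k" using in_n by auto
  then show False using p in_n kj jk unfolding avoids_321_def by blast
qed

text \<open>A strictly increasing function lists its image in order: once the values below
  \<open>j\<close> agree, the value at \<open>j\<close> is the least one left.\<close>

lemma strict_mono_on_image_eqD:
  fixes f g :: "nat \<Rightarrow> nat"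
  assumes f: "strict_mono_on A f" and g: "strict_mono_on A g" and eq: "f ` A = g ` A" and "j \<in> A"
  shows "f j = g j"
  using \<open>j \<in> A\<close>
proof (induction j rule: less_induct)
  case (less j)
  have *: "f' j \<le> g' j" if f': "strict_mono_on A f'" and g': "strict_mono_on A g'"
    and eq': "f' ` A = g' ` A" and IH: "\<And>i. i < j \<Longrightarrow> i \<in> A \<Longrightarrow> f' i = g' i" for f' g' :: "nat \<Rightarrow> nat"
  proof -
    obtain k where k: "k \<in> A" "g' j = f' k" using eq' less.prems by (metis image_iff)
    have "\<not> k < j" using IH[OF _ k(1)] k strict_mono_onD[OF g' k(1) less.prems] by auto
    then show ?thesis using k strict_mono_onD[OF f' less.prems k(1)] by (cases "k = j") auto
  qed
  show ?case using *[OF f g eq] *[OF g f eq[symmetric]] less.IH by (metis antisym)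
qed

text \<open>Both permutations increase on the anti-excedances and on the remaining positions, so
  each restriction is determined by its image.\<close>

lemma avoids_321_eqI:
  assumes p: "avoids_321 n p" and q: "avoids_321 n q"
    and eq: "antiexc p = antiexc q" "p ` antiexc p = q ` antiexc q"
  shows "p = q"
proof
  fix j
  let ?A = "antiexc p" and ?B = "{1..n} - antiexc p"
  have pq: "p permutes {1..n}" "q permutes {1..n}" using p q by (auto simp: avoids_321_def)
  have "p j = q j" if "j \<in> ?A"
    using that avoids_321_antiexc_mono[OF p] avoids_321_antiexc_mono[OF q] eq
    by (intro strict_mono_on_image_eqD[where A = ?A]) (auto intro!: strict_mono_onI)
  moreover have "p j = q j" if "j \<in> ?B"
  proof (rule strict_mono_on_image_eqD[OF _ _ _ that])
    show "strict_mono_on ?B p" "strict_mono_on ?B q"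
      using avoids_321_not_antiexc_mono[OF p] avoids_321_not_antiexc_mono[OF q] eq
      by (auto intro!: strict_mono_onI)
    show "p ` ?B = q ` ?B"
      using pq eq by (simp add: image_set_diff permutes_inj permutes_image)
  qed
  moreover have "p j = q j" if "j \<notin> {1..n}" using pq that by (simp add: permutes_not_in)
  ultimately show "p j = q j" by blast
qed

lemma finite_avoids_321: "finite {p. avoids_321 n p}"
  by (rule finite_subset[of _ "{p. p permutes {1..n}}"]) (auto simp: avoids_321_def finite_permutations)

text \<open>A partition with right endpoints \<open>antiexc p\<close> and left endpoints
  \<open>p\<close> \<open>antiexc p\<close> is chosen for each \<open>p\<close>; these two sets
  recover \<open>p\<close>.\<close>

lemma card_avoids_321_le: "card {p. avoids_321 n p} \<le> card {L. noncrossing_partition n L}"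
proof -
  have ex: "\<exists>L. noncrossing_partition n L \<and> Range L = antiexc p \<and> Domain L = p ` antiexc p"
    if "avoids_321 n p" for p
  proof -
    have perm: "p permutes {1..n}" using that by (simp add: avoids_321_def)
    note sub = antiexc_subset[OF perm]
    show ?thesis
    proof (rule noncrossing_exists)
      show "finite (antiexc p)" using sub finite_subset by blast
      show "bij_betw p (antiexc p) (p ` antiexc p)"
        using permutes_inj[OF perm] by (meson bij_betw_imageI inj_on_subset subset_UNIV)
      fix j assume "j \<in> antiexc p"
      then show "1 \<le> p j \<and> p j < j \<and> j \<le> n"
        using sub permutes_in_image[OF perm, of j] by (auto simp: antiexc_def)
    qed
  qed
  then obtain F where F: "\<And>p. avoids_321 n p \<Longrightarrow>
      noncrossing_partition n (F p) \<and> Range (F p) = antiexc p \<and> Domain (F p) = p ` antiexc p"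
    by metis
  have "inj_on F {p. avoids_321 n p}"
  proof (rule inj_onI)
    fix p q assume "p \<in> {p. avoids_321 n p}" "q \<in> {p. avoids_321 n p}" "F p = F q"
    then show "p = q" using F[of p] F[of q] by (intro avoids_321_eqI[of n]) auto
  qed
  then show ?thesis
    using F finite_Collect_noncrossing by (intro card_inj_on_le[of F]) auto
qed

section \<open>The action of the Temperley--Lieb algebra on functions of subsets\<close>

lemma monoid_alg_ops:
  "f \<oplus>\<^bsub>monoid_alg M\<^esub> g = (\<lambda>z. f z + g z)"
  "c \<odot>\<^bsub>monoid_alg M\<^esub> f = (\<lambda>z. c * f z)"
  "\<zero>\<^bsub>monoid_alg M\<^esub> = (\<lambda>z. 0)"
  "\<one>\<^bsub>monoid_alg M\<^esub> = basis_elt \<one>\<^bsub>M\<^esub>"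
  by (auto simp: monoid_alg_def basis_elt_def)

lemma basis_elt_carrier: "x \<in> carrier M \<Longrightarrow> basis_elt x \<in> carrier (monoid_alg M)"
  by (auto simp: monoid_alg_def basis_elt_def)

lemma basis_elt_mult:
  "basis_elt x \<otimes>\<^bsub>monoid_alg M\<^esub> basis_elt y = basis_elt (x \<otimes>\<^bsub>M\<^esub> y)"
proof
  fix z
  have "(basis_elt x \<otimes>\<^bsub>monoid_alg M\<^esub> basis_elt y) z
      = (\<Sum>x'\<in>{x}. \<Sum>y'\<in>{y}. if x' \<otimes>\<^bsub>M\<^esub> y' = z then basis_elt x x' * basis_elt y y' else 0)"
    by (rule monoid_alg_mult_eq) (auto simp: basis_elt_def split: if_splits)
  then show "(basis_elt x \<otimes>\<^bsub>monoid_alg M\<^esub> basis_elt y) z = basis_elt (x \<otimes>\<^bsub>M\<^esub> y) z"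
    by (simp add: basis_elt_def)
qed

lemma monoid_alg_induct [consumes 1, case_names zero basis add smult]:
  assumes f: "f \<in> carrier (monoid_alg M)"
    and zero: "P \<zero>\<^bsub>monoid_alg M\<^esub>"
    and basis: "\<And>x. x \<in> carrier M \<Longrightarrow> P (basis_elt x)"
    and add: "\<And>f g. f \<in> carrier (monoid_alg M) \<Longrightarrow> g \<in> carrier (monoid_alg M) \<Longrightarrow>
      P f \<Longrightarrow> P g \<Longrightarrow> P (f \<oplus>\<^bsub>monoid_alg M\<^esub> g)"
    and smult: "\<And>c f. f \<in> carrier (monoid_alg M) \<Longrightarrow> P f \<Longrightarrow> P (c \<odot>\<^bsub>monoid_alg M\<^esub> f)"
  shows "P f"
proof -
  have "P f" if "finite S" "{x. f x \<noteq> 0} \<subseteq> S" "S \<subseteq> carrier M" for S f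
    using that
  proof (induction S arbitrary: f rule: finite_induct)
    case empty
    then have "f = \<zero>\<^bsub>monoid_alg M\<^esub>" by (auto simp: monoid_alg_ops)
    then show ?case using zero by simp
  next
    case (insert x S)
    \<comment> \<open>The coordinate at \<open>x\<close> is split off as a multiple of a basis
      element; the rest is supported in \<open>S\<close>.\<close>
    let ?g = "f(x := 0)" and ?h = "f x \<odot>\<^bsub>monoid_alg M\<^esub> basis_elt x"
    have sub: "{z. ?g z \<noteq> 0} \<subseteq> S" using insert.prems by auto
    then have "?g \<in> carrier (monoid_alg M)"
      using insert.prems finite_subset[OF _ insert.hyps(1)] by (auto simp: monoid_alg_def)
    moreover have "P ?g" using insert sub by blast
    moreover have x: "x \<in> carrier M" using insert.prems by blast
    moreover have "?h \<in> carrier (monoid_alg M)"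
      by (rule monoid_alg_smult_closed[OF basis_elt_carrier[OF x]])
    moreover have "P ?h" by (rule smult[OF basis_elt_carrier[OF x] basis[OF x]])
    ultimately have "P (?h \<oplus>\<^bsub>monoid_alg M\<^esub> ?g)" using add by blast
    moreover have "?h \<oplus>\<^bsub>monoid_alg M\<^esub> ?g = f" by (auto simp: monoid_alg_ops basis_elt_def)
    ultimately show ?case by simp
  qed
  then show ?thesis using f by (auto simp: monoid_alg_def)
qed

lemma ring_quot_alg:
  assumes "ideal I A"
  shows "ring (quot_alg A I)"
proof -
  interpret Q: ring "A Quot I" using assms by (rule ideal.quotient_is_ring)
  show ?thesis
  proof (rule ringI)
    show "abelian_group (quot_alg A I)"
      by (rule abelian_groupI) (auto simp: quot_alg_def Q.add.m_ac intro: Q.l_neg)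
    show "monoid (quot_alg A I)"
      by (rule monoidI) (auto simp: quot_alg_def Q.m_assoc)
  qed (auto simp: quot_alg_def Q.l_distr Q.r_distr)
qed

lemma ring_TL: "ring (TL n \<delta>)"
  unfolding TL_def by (rule ring_quot_alg[OF ideal_tl_ideal])

lemma ring_tl_free: "ring (tl_free n)"
  unfolding tl_free_def by (rule ring_monoid_alg[OF monoid_free_monoid])

definition tl_class :: "nat \<Rightarrow> complex \<Rightarrow> (nat list \<Rightarrow> complex) \<Rightarrow> (nat list \<Rightarrow> complex) set" where
  "tl_class n \<delta> f = tl_ideal n \<delta> +>\<^bsub>tl_free n\<^esub> f"

lemma tl_gen_eq: "tl_gen n \<delta> i = tl_class n \<delta> (basis_elt [i])"
  by (simp add: tl_gen_def tl_class_def)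

lemma carrier_TL: "carrier (TL n \<delta>) = tl_class n \<delta> ` carrier (tl_free n)"
  by (auto simp: TL_def quot_alg_def FactRing_def A_RCOSETS_def' tl_class_def)

lemma tl_class_hom:
  assumes "f \<in> carrier (tl_free n)" "g \<in> carrier (tl_free n)"
  shows "tl_class n \<delta> f \<oplus>\<^bsub>TL n \<delta>\<^esub> tl_class n \<delta> g = tl_class n \<delta> (f \<oplus>\<^bsub>tl_free n\<^esub> g)"
    and "tl_class n \<delta> f \<otimes>\<^bsub>TL n \<delta>\<^esub> tl_class n \<delta> g = tl_class n \<delta> (f \<otimes>\<^bsub>tl_free n\<^esub> g)"
proof -
  interpret I: ideal "tl_ideal n \<delta>" "tl_free n" by (rule ideal_tl_ideal)
  show "tl_class n \<delta> f \<oplus>\<^bsub>TL n \<delta>\<^esub> tl_class n \<delta> g = tl_class n \<delta> (f \<oplus>\<^bsub>tl_free n\<^esub> g)"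
    using assms by (simp add: TL_def quot_alg_def FactRing_def tl_class_def I.a_rcos_sum)
  show "tl_class n \<delta> f \<otimes>\<^bsub>TL n \<delta>\<^esub> tl_class n \<delta> g = tl_class n \<delta> (f \<otimes>\<^bsub>tl_free n\<^esub> g)"
    using assms by (simp add: TL_def quot_alg_def FactRing_def tl_class_def I.rcoset_mult_add)
qed

lemma tl_class_smult:
  assumes "f \<in> carrier (tl_free n)"
  shows "c \<odot>\<^bsub>TL n \<delta>\<^esub> tl_class n \<delta> f = tl_class n \<delta> (c \<odot>\<^bsub>tl_free n\<^esub> f)"
  using assms quot_alg_smult[OF monoid_free_monoid] ideal_tl_ideal
  unfolding TL_def tl_class_def tl_free_def by blast

lemma tl_class_one: "tl_class n \<delta> \<one>\<^bsub>tl_free n\<^esub> = \<one>\<^bsub>TL n \<delta>\<^esub>"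
  by (simp add: TL_def quot_alg_def FactRing_def tl_class_def)

lemma tl_class_ideal: "f \<in> tl_ideal n \<delta> \<Longrightarrow> tl_class n \<delta> f = \<zero>\<^bsub>TL n \<delta>\<^esub>"
proof -
  interpret I: ideal "tl_ideal n \<delta>" "tl_free n" by (rule ideal_tl_ideal)
  show ?thesis if "f \<in> tl_ideal n \<delta>"
    using that by (simp add: TL_def quot_alg_def FactRing_def tl_class_def I.a_rcos_const)
qed

lemma tl_free_gen_carrier: "i \<in> {1..<n} \<Longrightarrow> basis_elt [i] \<in> carrier (tl_free n)"
  unfolding tl_free_def by (rule basis_elt_carrier) (simp add: free_monoid_def)

lemma tl_gen_braid:
  assumes "i \<in> {1..<n}" "j \<in> {1..<n}" "\<bar>int i - int j\<bar> = 1"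
  shows "tl_gen n \<delta> i \<otimes>\<^bsub>TL n \<delta>\<^esub> tl_gen n \<delta> j \<otimes>\<^bsub>TL n \<delta>\<^esub> tl_gen n \<delta> i = tl_gen n \<delta> i"
proof -
  interpret F: ring "tl_free n" by (rule ring_tl_free)
  interpret T: ring "TL n \<delta>" by (rule ring_TL)
  let ?e = "\<lambda>i. basis_elt [i]"
  note e = tl_free_gen_carrier[OF assms(1)] tl_free_gen_carrier[OF assms(2)]
  let ?x = "?e i \<otimes>\<^bsub>tl_free n\<^esub> ?e j \<otimes>\<^bsub>tl_free n\<^esub> ?e i"
  have "?x \<ominus>\<^bsub>tl_free n\<^esub> ?e i \<in> tl_rels n \<delta>"
    unfolding tl_rels_def Let_def using assms by blast
  then have "?x \<ominus>\<^bsub>tl_free n\<^esub> ?e i \<in> tl_ideal n \<delta>"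
    unfolding tl_ideal_def using F.genideal_self[OF tl_rels_subset] by blast
  then have "tl_class n \<delta> (?x \<ominus>\<^bsub>tl_free n\<^esub> ?e i) = \<zero>\<^bsub>TL n \<delta>\<^esub>" by (rule tl_class_ideal)
  \<comment> \<open>The ideal contains the difference of the two sides, so the right-hand side is
    added back.\<close>
  moreover have "?x = (?x \<ominus>\<^bsub>tl_free n\<^esub> ?e i) \<oplus>\<^bsub>tl_free n\<^esub> ?e i"
    using e by (simp add: F.minus_eq F.a_assoc F.l_neg)
  then have "tl_class n \<delta> ?x = tl_class n \<delta> (?x \<ominus>\<^bsub>tl_free n\<^esub> ?e i) \<oplus>\<^bsub>TL n \<delta>\<^esub> tl_class n \<delta> (?e i)"
    using e by (subst tl_class_hom) (auto simp del: One_nat_def)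
  moreover have "tl_class n \<delta> (?e i) \<in> carrier (TL n \<delta>)" using e carrier_TL by blast
  ultimately show ?thesis using e by (simp add: tl_gen_eq tl_class_hom)
qed

text \<open>A permutation \<open>p\<close> acts by \<open>v \<mapsto> (\<lambda>X. v (p -` X))\<close> on functions of subsets of \<open>\<nat>\<close>, which amounts to
  permuting the factors of \<open>(\<complex>\<^sup>2)\<^sup>\<otimes>\<^sup>n\<close>; so \<open>e\<^sub>i\<close> acts as \<open>1 - s\<^sub>i\<close>.\<close>

definition tl_op :: "nat \<Rightarrow> (nat set \<Rightarrow> complex) \<Rightarrow> nat set \<Rightarrow> complex" where
  "tl_op i v X = v X - v (transpose i (i + 1) -` X)"

text \<open>The first letter of a word acts last, so concatenation of words becomes composition of
  operators.\<close>

definition tl_act :: "(nat list \<Rightarrow> complex) \<Rightarrow> (nat set \<Rightarrow> complex) \<Rightarrow> nat set \<Rightarrow> complex" where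
  "tl_act f v X = (\<Sum>w | f w \<noteq> 0. f w * foldr tl_op w v X)"

lemma transpose_vimage_twice: "transpose a b -` transpose a b -` X = X"
  by (simp add: vimage_comp)

lemma transpose_vimage_eq: "a \<in> X \<longleftrightarrow> b \<in> X \<Longrightarrow> transpose a b -` X = X"
  by (auto simp: transpose_def split: if_splits)

text \<open>For an involution \<open>s\<close>, the square of \<open>1 - s\<close> is twice
  \<open>1 - s\<close>; this fixes the parameter 2.\<close>

lemma tl_op_square: "tl_op i (tl_op i v) X = 2 * tl_op i v X"
  by (simp add: tl_op_def transpose_vimage_twice)

lemma tl_op_commute:
  assumes "\<bar>int i - int j\<bar> > 1"
  shows "tl_op i (tl_op j v) X = tl_op j (tl_op i v) X"
proof -
  have "transpose i (i + 1) \<circ> transpose j (j + 1) = transpose j (j + 1) \<circ> transpose i (i + 1)"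
    using assms by (intro ext) (auto simp: transpose_def)
  then have "transpose j (j + 1) -` transpose i (i + 1) -` X = transpose i (i + 1) -` transpose j (j + 1) -` X"
    by (simp only: vimage_comp)
  then show ?thesis by (simp add: tl_op_def)
qed

text \<open>Two of the three points lie both in \<open>X\<close> or both outside \<open>X\<close>; the transposition of these two
  fixes \<open>X\<close> and pairs off the terms.\<close>

lemma antisymmetrizer_vimage:
  fixes v :: "nat set \<Rightarrow> complex"
  assumes "distinct [a, b, c]"
  defines "s \<equiv> (-`) (transpose a b)" and "t \<equiv> (-`) (transpose b c)"
  shows "v X - v (s X) - v (t X) + v (t (s X)) + v (s (t X)) - v (s (t (s X))) = 0"
proof -
  have "transpose a b \<circ> (transpose b c \<circ> transpose a b) = transpose a c"
    "transpose b c \<circ> (transpose a b \<circ> transpose b c) = transpose a c"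
    using assms(1) by (auto simp: fun_eq_iff transpose_def)
  then have sts: "s (t (s Y)) = transpose a c -` Y" and tst: "t (s (t Y)) = transpose a c -` Y" for Y
    by (simp_all add: s_def t_def vimage_comp comp_assoc)
  have ss: "s (s Y) = Y" and tt: "t (t Y) = Y" for Y
    by (simp_all only: s_def t_def transpose_vimage_twice)
  consider "a \<in> X \<longleftrightarrow> b \<in> X" | "b \<in> X \<longleftrightarrow> c \<in> X" | "a \<in> X \<longleftrightarrow> c \<in> X" by blast
  then show ?thesis
  proof cases
    case 1
    then have "s X = X" unfolding s_def by (rule transpose_vimage_eq)
    then show ?thesis by simp
  next
    case 2
    then have "t X = X" unfolding t_def by (rule transpose_vimage_eq)
    then show ?thesis using sts[of X] tst[of X] by simp
  next
    case 3
    then have "transpose a c -` X = X" by (rule transpose_vimage_eq)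
    \<comment> \<open>Here \<open>s t s\<close> and \<open>t s t\<close> both fix \<open>X\<close>,
      and cancelling an involution identifies the remaining sets in pairs.\<close>
    then have eq: "s (t (s X)) = X" "t (s (t X)) = X" using sts tst by auto
    then have "t (s X) = s X" "s (t X) = t X" using ss tt by metis+
    then show ?thesis using eq by simp
  qed
qed

text \<open>Expanding \<open>(1 - s)(1 - t)(1 - s) - (1 - s)\<close> with \<open>s s = 1\<close>
  gives exactly the antisymmetrizer \<open>1 - s - t + s t + t s - s t s\<close>.\<close>

lemma tl_op_braid:
  assumes "\<bar>int i - int j\<bar> = 1"
  shows "tl_op i (tl_op j (tl_op i v)) X = tl_op i v X"
proof -
  \<comment> \<open>The letter shared by the two transpositions is named \<open>b\<close>.\<close>
  obtain a b c where abc: "distinct [a, b, c]" "transpose i (i + 1) = transpose a b"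
    "transpose j (j + 1) = transpose b c"
  proof (cases "j = i + 1")
    case True
    then show ?thesis using that[of i "i + 1" "i + 2"] by simp
  next
    case False
    then have "i = j + 1" using assms by linarith
    then show ?thesis using that[of "i + 1" i j] by (simp add: transpose_commute)
  qed
  show ?thesis
    using antisymmetrizer_vimage[OF abc(1), of v X]
    unfolding tl_op_def abc(2,3) transpose_vimage_twice by (simp add: algebra_simps)
qed

lemma foldr_tl_op_sum:
  "foldr tl_op w (\<lambda>X. \<Sum>y\<in>T. c y * u y X) = (\<lambda>X. \<Sum>y\<in>T. c y * foldr tl_op w (u y) X)"
  by (induction w) (auto simp: tl_op_def sum_subtractf right_diff_distrib)

lemma tl_act_eq:
  assumes "finite S" "{w. f w \<noteq> 0} \<subseteq> S"
  shows "tl_act f v X = (\<Sum>w\<in>S. f w * foldr tl_op w v X)"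
  unfolding tl_act_def using assms by (intro sum.mono_neutral_left) auto

lemma tl_free_finite: "f \<in> carrier (tl_free n) \<Longrightarrow> finite {w. f w \<noteq> 0}"
  by (simp add: tl_free_def monoid_alg_def)

lemma tl_act_basis: "tl_act (basis_elt w) v = foldr tl_op w v"
  by (rule ext, subst tl_act_eq[where S = "{w}"]) (auto simp: basis_elt_def split: if_splits)

lemma tl_act_add:
  assumes "f \<in> carrier (tl_free n)" "g \<in> carrier (tl_free n)"
  shows "tl_act (f \<oplus>\<^bsub>tl_free n\<^esub> g) v X = tl_act f v X + tl_act g v X"
proof -
  let ?S = "{w. f w \<noteq> 0} \<union> {w. g w \<noteq> 0}"
  have "finite ?S" using assms by (simp add: tl_free_finite)
  then show ?thesis
    by (subst (1 2 3) tl_act_eq[where S = ?S])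
      (auto simp: tl_free_def monoid_alg_ops sum.distrib algebra_simps)
qed

lemma tl_act_smult:
  assumes "f \<in> carrier (tl_free n)"
  shows "tl_act (c \<odot>\<^bsub>tl_free n\<^esub> f) v X = c * tl_act f v X"
  using tl_free_finite[OF assms]
  by (subst (1 2) tl_act_eq[where S = "{w. f w \<noteq> 0}"])
    (auto simp: tl_free_def monoid_alg_ops sum_distrib_left algebra_simps)

lemma tl_act_minus:
  assumes "f \<in> carrier (tl_free n)" "g \<in> carrier (tl_free n)"
  shows "tl_act (f \<ominus>\<^bsub>tl_free n\<^esub> g) v X = tl_act f v X - tl_act g v X"
proof -
  interpret F: ring "tl_free n" by (rule ring_tl_free)
  have "f = (f \<ominus>\<^bsub>tl_free n\<^esub> g) \<oplus>\<^bsub>tl_free n\<^esub> g"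
    using assms by (simp add: F.minus_eq F.a_assoc F.l_neg)
  then have "tl_act f v X = tl_act (f \<ominus>\<^bsub>tl_free n\<^esub> g) v X + tl_act g v X"
    using tl_act_add[OF F.minus_closed[OF assms] assms(2)] by metis
  then show ?thesis by simp
qed

lemma tl_act_mult:
  assumes "f \<in> carrier (tl_free n)" "g \<in> carrier (tl_free n)"
  shows "tl_act (f \<otimes>\<^bsub>tl_free n\<^esub> g) v = tl_act f (tl_act g v)"
proof
  fix X
  let ?S = "{w. f w \<noteq> 0}" and ?T = "{w. g w \<noteq> 0}"
  interpret F: ring "tl_free n" by (rule ring_tl_free)
  have fin: "finite ?S" "finite ?T" using assms by (auto simp: tl_free_finite)
  \<comment> \<open>\<open>V\<close> contains the support of the product and every concatenation, so
    each inner sum over \<open>V\<close> meets its one index \<open>x @ y\<close>.\<close>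
  define V where "V = {w. (f \<otimes>\<^bsub>tl_free n\<^esub> g) w \<noteq> 0} \<union> (\<lambda>(x, y). x @ y) ` (?S \<times> ?T)"
  have finV: "finite V" using fin tl_free_finite[OF F.m_closed[OF assms]] by (simp add: V_def)
  have prod: "(f \<otimes>\<^bsub>tl_free n\<^esub> g) w = (\<Sum>x\<in>?S. \<Sum>y\<in>?T. if x @ y = w then f x * g y else 0)" for w
    using monoid_alg_mult_eq[OF fin order_refl order_refl, of "free_monoid {1..<n}" w]
    by (simp add: tl_free_def free_monoid_def)
  have "tl_act (f \<otimes>\<^bsub>tl_free n\<^esub> g) v X
      = (\<Sum>w\<in>V. (\<Sum>x\<in>?S. \<Sum>y\<in>?T. if x @ y = w then f x * g y else 0) * foldr tl_op w v X)"
    by (subst tl_act_eq[OF finV]) (auto simp: V_def prod)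
  also have "\<dots> = (\<Sum>w\<in>V. \<Sum>x\<in>?S. \<Sum>y\<in>?T. if x @ y = w then f x * g y * foldr tl_op w v X else 0)"
    by (auto simp: sum_distrib_right intro!: sum.cong)
  also have "\<dots> = (\<Sum>x\<in>?S. \<Sum>w\<in>V. \<Sum>y\<in>?T. if x @ y = w then f x * g y * foldr tl_op w v X else 0)"
    by (rule sum.swap)
  also have "\<dots> = (\<Sum>x\<in>?S. \<Sum>y\<in>?T. \<Sum>w\<in>V. if x @ y = w then f x * g y * foldr tl_op w v X else 0)"
    by (intro sum.cong refl sum.swap)
  also have "\<dots> = (\<Sum>x\<in>?S. \<Sum>y\<in>?T. f x * g y * foldr tl_op (x @ y) v X)"
    using finV by (intro sum.cong refl) (auto simp: V_def sum.delta')
  also have "\<dots> = (\<Sum>x\<in>?S. f x * (\<Sum>y\<in>?T. g y * foldr tl_op x (foldr tl_op y v) X))"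
    by (simp add: sum_distrib_left mult.assoc)
  also have "\<dots> = (\<Sum>x\<in>?S. f x * foldr tl_op x (tl_act g v) X)"
    unfolding tl_act_def foldr_tl_op_sum ..
  also have "\<dots> = tl_act f (tl_act g v) X" by (simp add: tl_act_def)
  finally show "tl_act (f \<otimes>\<^bsub>tl_free n\<^esub> g) v X = tl_act f (tl_act g v) X" .
qed

lemma foldr_tl_op_zero: "foldr tl_op w (\<lambda>_. 0) = (\<lambda>_. 0)"
  by (induction w) (auto simp: tl_op_def)

text \<open>The elements acting as zero form a two-sided ideal that contains the relations, hence
  the ideal they generate.\<close>

lemma tl_act_ideal:
  assumes "f \<in> tl_ideal n 2"
  shows "tl_act f v X = 0"
proof -
  let ?F = "tl_free n"
  interpret F: ring ?F by (rule ring_tl_free)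
  define K where "K = {f \<in> carrier ?F. \<forall>v X. tl_act f v X = 0}"
  have zero: "tl_act f (\<lambda>_. 0) X = 0" for f X
    by (simp add: tl_act_def foldr_tl_op_zero)
  have ab: "\<ominus>\<^bsub>?F\<^esub> f \<in> K" if "f \<in> K" for f
  proof -
    have "\<zero>\<^bsub>?F\<^esub> \<ominus>\<^bsub>?F\<^esub> f = \<ominus>\<^bsub>?F\<^esub> f" using that by (simp add: K_def F.minus_eq)
    moreover have "tl_act \<zero>\<^bsub>?F\<^esub> v X = 0" for v X
      by (simp add: tl_free_def monoid_alg_ops tl_act_def)
    ultimately show ?thesis
      using that tl_act_minus[OF F.zero_closed, of f] by (auto simp: K_def)
  qed
  have "ideal K ?F"
  proof (rule idealI)
    show "ring ?F" by (rule ring_tl_free)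
    show "subgroup K (add_monoid ?F)"
    proof (rule F.add.subgroupI)
      show "K \<noteq> {}"
        using F.zero_closed by (auto simp: K_def tl_free_def monoid_alg_ops tl_act_def intro!: exI[of _ "\<lambda>_. 0"])
    qed (use ab in \<open>auto simp: K_def tl_act_add a_inv_def\<close>)
  next
    fix a x assume "a \<in> K" "x \<in> carrier ?F"
    moreover from \<open>a \<in> K\<close> have "tl_act a v = (\<lambda>_. 0)" for v by (auto simp: K_def)
    ultimately show "x \<otimes>\<^bsub>?F\<^esub> a \<in> K" "a \<otimes>\<^bsub>?F\<^esub> x \<in> K"
      using zero by (auto simp: K_def tl_act_mult)
  qed
  moreover have "tl_rels n 2 \<subseteq> K"
  proof -
    note e = tl_free_gen_carrier
    have sm: "c \<odot>\<^bsub>?F\<^esub> f \<in> carrier ?F" if "f \<in> carrier ?F" for c f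
      using that monoid_alg_smult_closed unfolding tl_free_def by blast
    show ?thesis
      unfolding tl_rels_def Let_def K_def
      by (auto simp del: One_nat_def simp: e sm tl_act_minus tl_act_mult tl_act_smult tl_act_basis
          tl_op_square tl_op_commute tl_op_braid)
  qed
  ultimately have "tl_ideal n 2 \<subseteq> K"
    unfolding tl_ideal_def by (rule F.genideal_minimal)
  then show ?thesis using assms by (auto simp: K_def)
qed

section \<open>The representation of the quotient algebra\<close>

definition tl_rep :: "(nat list \<Rightarrow> complex) set \<Rightarrow> (nat set \<Rightarrow> complex) \<Rightarrow> nat set \<Rightarrow> complex" where
  "tl_rep C = tl_act (SOME f. f \<in> C)"

text \<open>The choice of representative is harmless: two of them differ by an element of the ideal,
  which acts as zero.\<close>

lemma tl_rep_class:
  assumes "f \<in> carrier (tl_free n)"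
  shows "tl_rep (tl_class n 2 f) = tl_act f"
proof -
  interpret I: ideal "tl_ideal n 2" "tl_free n" by (rule ideal_tl_ideal)
  have "f \<in> tl_class n 2 f" unfolding tl_class_def by (rule I.a_rcos_self[OF assms])
  then have "(SOME f'. f' \<in> tl_class n 2 f) \<in> tl_class n 2 f" by (metis someI)
  then obtain a where a: "a \<in> tl_ideal n 2" "(SOME f'. f' \<in> tl_class n 2 f) = a \<oplus>\<^bsub>tl_free n\<^esub> f"
    by (auto simp: tl_class_def a_r_coset_def')
  then show ?thesis
    using tl_act_add[OF I.a_Hcarr[OF a(1)] assms] tl_act_ideal[OF a(1)]
    unfolding tl_rep_def a(2) by (simp add: fun_eq_iff)
qed

lemma tl_rep_hom:
  assumes "x \<in> carrier (TL n 2)" "y \<in> carrier (TL n 2)"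
  shows "tl_rep (x \<oplus>\<^bsub>TL n 2\<^esub> y) v X = tl_rep x v X + tl_rep y v X"
    and "tl_rep (x \<otimes>\<^bsub>TL n 2\<^esub> y) v = tl_rep x (tl_rep y v)"
    and "tl_rep (x \<ominus>\<^bsub>TL n 2\<^esub> y) v X = tl_rep x v X - tl_rep y v X"
proof -
  interpret F: ring "tl_free n" by (rule ring_tl_free)
  interpret T: ring "TL n 2" by (rule ring_TL)
  have add: "tl_rep (x \<oplus>\<^bsub>TL n 2\<^esub> y) v X = tl_rep x v X + tl_rep y v X"
    if "x \<in> carrier (TL n 2)" "y \<in> carrier (TL n 2)" for x y
    using that by (auto simp: carrier_TL tl_class_hom tl_rep_class tl_act_add)
  then show "tl_rep (x \<oplus>\<^bsub>TL n 2\<^esub> y) v X = tl_rep x v X + tl_rep y v X" using assms by blast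
  show "tl_rep (x \<otimes>\<^bsub>TL n 2\<^esub> y) v = tl_rep x (tl_rep y v)"
    using assms by (auto simp: carrier_TL tl_class_hom tl_rep_class tl_act_mult)
  have "x = (x \<ominus>\<^bsub>TL n 2\<^esub> y) \<oplus>\<^bsub>TL n 2\<^esub> y"
    using assms by (simp add: T.minus_eq T.a_assoc T.l_neg)
  then have "tl_rep x v X = tl_rep (x \<ominus>\<^bsub>TL n 2\<^esub> y) v X + tl_rep y v X"
    using add[OF T.minus_closed[OF assms] assms(2)] by metis
  then show "tl_rep (x \<ominus>\<^bsub>TL n 2\<^esub> y) v X = tl_rep x v X - tl_rep y v X" by simp
qed

lemma tl_rep_smult:
  assumes "x \<in> carrier (TL n 2)"
  shows "tl_rep (c \<odot>\<^bsub>TL n 2\<^esub> x) v X = c * tl_rep x v X"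
proof -
  have "c \<odot>\<^bsub>tl_free n\<^esub> f \<in> carrier (tl_free n)" if "f \<in> carrier (tl_free n)" for f
    using that monoid_alg_smult_closed unfolding tl_free_def by blast
  then show ?thesis
    using assms by (auto simp: carrier_TL tl_class_smult tl_rep_class tl_act_smult)
qed

lemma tl_rep_one: "tl_rep \<one>\<^bsub>TL n 2\<^esub> v = v"
proof -
  interpret F: ring "tl_free n" by (rule ring_tl_free)
  show ?thesis
    using tl_rep_class[OF F.one_closed]
    by (simp add: tl_class_one[symmetric] tl_free_def monoid_alg_ops tl_act_basis free_monoid_def)
qed

lemma tl_rep_zero: "tl_rep \<zero>\<^bsub>TL n 2\<^esub> v X = 0"
proof -
  interpret T: ring "TL n 2" by (rule ring_TL)
  show ?thesis using tl_rep_hom(1)[OF T.zero_closed T.zero_closed, of v X] by simp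
qed

lemma tl_gen_carrier: "i \<in> {1..<n} \<Longrightarrow> tl_gen n \<delta> i \<in> carrier (TL n \<delta>)"
  unfolding tl_gen_eq carrier_TL by (intro imageI tl_free_gen_carrier)

lemma tl_rep_gen: "i \<in> {1..<n} \<Longrightarrow> tl_rep (tl_gen n 2 i) = tl_op i"
  using tl_rep_class[OF tl_free_gen_carrier] by (auto simp: tl_gen_eq tl_act_basis)

section \<open>Spanning and linear independence\<close>

lemma transpose_adjacent_induct:
  assumes "a < (b :: nat)" "b \<le> n" "1 \<le> a"
    and gen: "\<And>i. i \<in> {1..<n} \<Longrightarrow> P (transpose i (i + 1))"
    and comp: "\<And>p q. p permutes {1..n} \<Longrightarrow> q permutes {1..n} \<Longrightarrow> P p \<Longrightarrow> P q \<Longrightarrow> P (p \<circ> q)"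
  shows "P (transpose a b)"
  using assms(1,2)
proof (induction b)
  case (Suc b)
  show ?case
  proof (cases "a = b")
    case True
    then show ?thesis using gen[of b] Suc.prems \<open>1 \<le> a\<close> by simp
  next
    case False
    then have b: "a < b" "b < n" using Suc.prems by auto
    let ?s = "transpose b (b + 1)"
    have perm: "?s permutes {1..n}" "transpose a b permutes {1..n}"
      using b \<open>1 \<le> a\<close> by (auto intro!: permutes_swap_id)
    \<comment> \<open>Conjugation by the adjacent transposition \<open>?s\<close> moves the upper
      letter from \<open>b\<close> to \<open>b + 1\<close>.\<close>
    have "transpose a (Suc b) = ?s \<circ> (transpose a b \<circ> ?s)"
      using b by (auto simp: fun_eq_iff transpose_def)
    moreover have "P (transpose a b)" "P ?s" using Suc.IH gen[of b] b \<open>1 \<le> a\<close> by auto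
    ultimately show ?thesis using comp perm permutes_compose by metis
  qed
qed simp

lemma adjacent_transposition_induct [consumes 1, case_names id gen comp]:
  assumes p: "p permutes {1..n::nat}" and id: "P id"
    and gen: "\<And>i. i \<in> {1..<n} \<Longrightarrow> P (transpose i (i + 1))"
    and comp: "\<And>p q. p permutes {1..n} \<Longrightarrow> q permutes {1..n} \<Longrightarrow> P p \<Longrightarrow> P q \<Longrightarrow> P (p \<circ> q)"
  shows "P p"
  using p finite_atLeastAtMost[of 1 n]
proof (induction p rule: permutes_induct)
  case (swap a b p)
  have "P (transpose a b)"
  proof (cases "a < b")
    case True
    then show ?thesis using swap.hyps transpose_adjacent_induct[of a b n P] gen comp by auto
  next
    case False
    then show ?thesis
      using swap.hyps transpose_adjacent_induct[of b a n P] gen comp by (auto simp: transpose_commute)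
  qed
  then show ?case
    by (rule comp[OF permutes_swap_id[OF swap.hyps(1,2)] swap.hyps(4) _ swap.IH])
qed (rule id)

text \<open>The antisymmetrizer vanishes; even products stand on the left and odd ones on the right,
  so no signs occur.\<close>

lemma (in ring) antisymmetrizer_eq:
  assumes "s \<in> carrier R" "t \<in> carrier R" "s \<otimes> s = \<one>"
    and braid: "(\<one> \<ominus> s) \<otimes> (\<one> \<ominus> t) \<otimes> (\<one> \<ominus> s) = \<one> \<ominus> s"
  shows "\<one> \<oplus> s \<otimes> t \<oplus> t \<otimes> s = s \<oplus> t \<oplus> s \<otimes> t \<otimes> s"
proof -
  have sst: "s \<otimes> (s \<otimes> x) = x" if "x \<in> carrier R" for x
    using assms that by (simp flip: m_assoc)
  have cancel: "x \<oplus> (y \<oplus> (z \<oplus> (\<ominus> x \<oplus> w))) = y \<oplus> (z \<oplus> w)"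
    if "x \<in> carrier R" "y \<in> carrier R" "z \<in> carrier R" "w \<in> carrier R" for x y z w
  proof -
    have "x \<oplus> (y \<oplus> (z \<oplus> (\<ominus> x \<oplus> w))) = y \<oplus> (z \<oplus> (x \<oplus> (\<ominus> x \<oplus> w)))"
      using that by (simp only: a_lcomm a_closed a_inv_closed)
    then show ?thesis using that by (simp add: r_neg2)
  qed
  \<comment> \<open>Expanded, the triple product is \<open>2 - 2 s - t + s t + t s - s t s\<close>;
    the added terms cancel its negative part.\<close>
  have "\<one> \<oplus> (\<one> \<oplus> s \<otimes> t \<oplus> t \<otimes> s) = (\<one> \<ominus> s) \<otimes> (\<one> \<ominus> t) \<otimes> (\<one> \<ominus> s) \<oplus> s \<oplus> (s \<oplus> t \<oplus> s \<otimes> t \<otimes> s)"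
    using assms(1-3) by (simp add: minus_eq l_distr r_distr l_minus r_minus minus_add a_ac m_assoc r_neg r_neg2 sst cancel)
  also have "\<dots> = \<one> \<oplus> (s \<oplus> t \<oplus> s \<otimes> t \<otimes> s)"
    unfolding braid using assms(1,2) by (simp add: minus_eq a_assoc l_neg)
  finally show ?thesis using assms(1,2) by simp
qed

lemma comp_transpose: "inj f \<Longrightarrow> f \<circ> transpose x y = transpose (f x) (f y) \<circ> f"
  by (auto simp: fun_eq_iff transpose_def inj_eq)

lemma permutes_exists_3:
  assumes "distinct [a, b, c]" "{a, b, c} \<subseteq> {1..n::nat}"
  shows "\<exists>p. p permutes {1..n} \<and> p 1 = a \<and> p 2 = b \<and> p 3 = c"
proof -
  have "card {a, b, c} \<le> card {1..n}" using assms(2) by (intro card_mono) auto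
  then have n: "3 \<le> n" using assms(1) by simp
  \<comment> \<open>\<open>b'\<close> and \<open>c'\<close> are the preimages of \<open>b\<close>
    and \<open>c\<close> under the transpositions applied after those that place them.\<close>
  define b' where "b' = transpose 1 a b"
  define c' where "c' = transpose 2 b' (transpose 1 a c)"
  let ?p = "transpose 1 a \<circ> (transpose 2 b' \<circ> transpose 3 c')"
  have b': "b' \<in> {1..n}" "b' \<noteq> 1" using assms n by (auto simp: b'_def transpose_def)
  then have c': "c' \<in> {1..n}" "c' \<noteq> 1" "c' \<noteq> 2"
    using assms n by (auto simp: c'_def b'_def transpose_def split: if_splits)
  have "?p permutes {1..n}"
    using assms n b' c' by (intro permutes_compose permutes_swap_id) auto
  moreover have "?p 1 = a" using b' c' by (simp add: transpose_def)
  moreover have "?p 2 = b" using c' by (simp add: b'_def)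
  moreover have "?p 3 = c" by (simp add: c'_def)
  ultimately show ?thesis by blast
qed

section \<open>Homomorphisms from the group algebra that send \<open>s\<^sub>i\<close> to
  \<open>1 - e\<^sub>i\<close>\<close>

locale tl_hom =
  fixes n :: nat and \<phi> :: "((nat \<Rightarrow> nat) \<Rightarrow> complex) \<Rightarrow> (nat list \<Rightarrow> complex) set"
  assumes hom: "\<phi> \<in> alg_hom (monoid_alg (sym_group n)) (TL n 2)"
    and adjacent: "\<And>i. i \<in> {1..<n} \<Longrightarrow>
      \<phi> (basis_elt (transpose i (i + 1))) = \<one>\<^bsub>TL n 2\<^esub> \<ominus>\<^bsub>TL n 2\<^esub> tl_gen n 2 i"
begin

abbreviation "A \<equiv> monoid_alg (sym_group n)"
abbreviation "T \<equiv> TL n 2"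
abbreviation "\<psi> p \<equiv> \<phi> (basis_elt p)"

sublocale T: ring T by (rule ring_TL)
sublocale A: ring A by (rule ring_monoid_alg) (simp add: group.is_monoid sym_group_is_group)
sublocale V: vectorspace class_ring T by (rule vectorspace_TL)

lemma \<phi>_hom:
  "f \<in> carrier A \<Longrightarrow> \<phi> f \<in> carrier T"
  "f \<in> carrier A \<Longrightarrow> g \<in> carrier A \<Longrightarrow> \<phi> (f \<oplus>\<^bsub>A\<^esub> g) = \<phi> f \<oplus>\<^bsub>T\<^esub> \<phi> g"
  "f \<in> carrier A \<Longrightarrow> g \<in> carrier A \<Longrightarrow> \<phi> (f \<otimes>\<^bsub>A\<^esub> g) = \<phi> f \<otimes>\<^bsub>T\<^esub> \<phi> g"
  "f \<in> carrier A \<Longrightarrow> \<phi> (c \<odot>\<^bsub>A\<^esub> f) = c \<odot>\<^bsub>T\<^esub> \<phi> f"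
  "\<phi> \<one>\<^bsub>A\<^esub> = \<one>\<^bsub>T\<^esub>"
  using hom by (auto simp: alg_hom_def Ring.ring_hom_def LinearCombinations.module_hom_def)

lemma basis_elt_closed: "p permutes {1..n} \<Longrightarrow> basis_elt p \<in> carrier A"
  by (rule basis_elt_carrier) (simp add: sym_group_carrier)

lemma \<psi>_closed [simp]: "p permutes {1..n} \<Longrightarrow> \<psi> p \<in> carrier T"
  by (intro \<phi>_hom basis_elt_closed)

lemma \<psi>_comp:
  assumes "p permutes {1..n}" "q permutes {1..n}"
  shows "\<psi> (p \<circ> q) = \<psi> p \<otimes>\<^bsub>T\<^esub> \<psi> q"
  using \<phi>_hom(3)[OF basis_elt_closed[OF assms(1)] basis_elt_closed[OF assms(2)]]
  by (simp add: basis_elt_mult sym_group_mult)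

lemma \<psi>_id: "\<psi> id = \<one>\<^bsub>T\<^esub>"
  using \<phi>_hom(5) by (simp add: monoid_alg_ops sym_group_one)

text \<open>Both sides turn products into compositions, so adjacent transpositions suffice, where
  \<open>1 - (1 - s) = s\<close>.\<close>

lemma tl_rep_\<psi>:
  assumes "p permutes {1..n}"
  shows "tl_rep (\<psi> p) = (\<lambda>v X. v (p -` X))"
  using assms
proof (induction p rule: adjacent_transposition_induct)
  case id
  show ?case unfolding \<psi>_id by (intro ext) (simp add: tl_rep_one)
next
  case (gen i)
  then show ?case
    by (simp only: adjacent fun_eq_iff tl_rep_hom(3)[OF T.one_closed tl_gen_carrier] tl_rep_one tl_rep_gen)
      (simp add: tl_op_def)
next
  case (comp p q)
  then show ?case
    by (intro ext) (simp only: \<psi>_comp tl_rep_hom(2) \<psi>_closed vimage_comp)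
qed

section \<open>Linear independence\<close>

lemma tl_rep_lincomb:
  assumes "finite B" "B \<subseteq> carrier T"
  shows "tl_rep (V.lincomb a B) v X = (\<Sum>t\<in>B. a t * tl_rep t v X)"
  using assms
proof (induction B rule: finite_induct)
  case empty
  then show ?case by (simp add: V.lincomb_def tl_rep_zero)
next
  case (insert t B)
  have cl: "V.lincomb a B \<in> carrier T" "a t \<odot>\<^bsub>T\<^esub> t \<in> carrier T"
    using insert.prems by (auto intro!: V.lincomb_closed)
  have "V.lincomb a (insert t B) = a t \<odot>\<^bsub>T\<^esub> t \<oplus>\<^bsub>T\<^esub> V.lincomb a B"
    using V.lincomb_insert[of B a t] insert by simp
  then show ?case using insert cl by (simp add: tl_rep_hom(1) tl_rep_smult)
qed

lemma tl_rep_Q_perm: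
  assumes "noncrossing_partition n M"
  shows "tl_rep (\<psi> (Q_perm M)) (\<lambda>Y. if Y = Range L then 1 else 0) (Domain L)
    = (if Q_perm M -` Domain L = Range L then 1 else 0)"
  using tl_rep_\<psi>[OF Q_perm_permutes[OF assms]] by simp

text \<open>Equal images have equal matrix entries, so the diagonal entries force both mixed entries
  to be 1. If \<open>L \<noteq> M\<close>, each weight would be smaller than the other.\<close>

lemma inj_on_\<psi>_Q_perm: "inj_on (\<psi> \<circ> Q_perm) {L. noncrossing_partition n L}"
proof (rule inj_onI)
  fix L M assume "L \<in> {L. noncrossing_partition n L}" "M \<in> {L. noncrossing_partition n L}"
    and eq: "(\<psi> \<circ> Q_perm) L = (\<psi> \<circ> Q_perm) M"
  then have nc: "noncrossing_partition n L" "noncrossing_partition n M" by auto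
  have "Q_perm M -` Domain L = Range L" "Q_perm L -` Domain M = Range M"
    using tl_rep_Q_perm[OF nc(1), of L] tl_rep_Q_perm[OF nc(2), of L]
      tl_rep_Q_perm[OF nc(1), of M] tl_rep_Q_perm[OF nc(2), of M] eq
      Q_perm_vimage_Domain[OF nc(1)] Q_perm_vimage_Domain[OF nc(2)]
    by (auto split: if_splits)
  then show "L = M" using arc_weight_mono[OF nc] arc_weight_mono[OF nc(2,1)] by force
qed

lemma QSV_eq: "\<phi> ` basis_elt ` QSV n = (\<psi> \<circ> Q_perm) ` {L. noncrossing_partition n L}"
  by (auto simp: QSV_def)

lemma QSV_image_carrier: "\<phi> ` basis_elt ` QSV n \<subseteq> carrier T"
  by (auto simp: QSV_eq intro!: \<psi>_closed Q_perm_permutes)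

lemma lin_indpt_QSV: "V.lin_indpt (\<phi> ` basis_elt ` QSV n)"
proof
  assume "V.lin_dep (\<phi> ` basis_elt ` QSV n)"
  then obtain B a t where B: "finite B" "B \<subseteq> \<phi> ` basis_elt ` QSV n"
    and zero: "V.lincomb a B = \<zero>\<^bsub>T\<^esub>" and t: "t \<in> B" "a t \<noteq> 0"
    by (auto simp: V.lin_dep_def)
  \<comment> \<open>In a nontrivial relation, a partition \<open>L\<close> of maximal weight among
    those with nonzero coefficient is selected.\<close>
  define N where "N = {L. noncrossing_partition n L \<and> \<psi> (Q_perm L) \<in> B \<and> a (\<psi> (Q_perm L)) \<noteq> 0}"
  have "finite N" unfolding N_def using finite_Collect_noncrossing by (rule rev_finite_subset) auto
  moreover have "N \<noteq> {}" using B t by (force simp: N_def QSV_eq)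
  ultimately have "Max (arc_weight ` N) \<in> arc_weight ` N" by (intro Max_in) auto
  then obtain L where L: "L \<in> N" "Max (arc_weight ` N) = arc_weight L" by blast
  have max: "arc_weight M \<le> arc_weight L" if "M \<in> N" for M
    unfolding L(2)[symmetric] using that \<open>finite N\<close> by simp
  have nc: "noncrossing_partition n L" and LB: "\<psi> (Q_perm L) \<in> B" and aL: "a (\<psi> (Q_perm L)) \<noteq> 0"
    using L(1) by (auto simp: N_def)
  let ?v = "\<lambda>Y. if Y = Range L then 1 else 0"
  \<comment> \<open>Applying the relation to the indicator of \<open>Range L\<close> and evaluating
    at \<open>Domain L\<close> isolates the coefficient of \<open>Q_perm L\<close>: any other term
    with a nonzero entry has larger weight.\<close>
  have "a s * tl_rep s ?v (Domain L) = (if s = \<psi> (Q_perm L) then a s else 0)" if s: "s \<in> B" for s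
  proof -
    obtain M where M: "noncrossing_partition n M" "s = \<psi> (Q_perm M)" using B s by (auto simp: QSV_eq)
    show ?thesis
    proof (cases "a s \<noteq> 0 \<and> Q_perm M -` Domain L = Range L")
      case True
      then have "M \<in> N" using M s by (simp add: N_def)
      then have "L = M" using arc_weight_mono[OF nc M(1)] max True by fastforce
      then show ?thesis using M True by (simp add: tl_rep_Q_perm)
    next
      case False
      show ?thesis
      proof (cases "a s = 0")
        case a: False
        have r0: "tl_rep s ?v (Domain L) = 0"
          using tl_rep_Q_perm[OF M(1), of L] M(2) False a by simp
        have "tl_rep (\<psi> (Q_perm L)) ?v (Domain L) = 1"
          using tl_rep_Q_perm[OF nc, of L] Q_perm_vimage_Domain[OF nc] by simp
        then have "s \<noteq> \<psi> (Q_perm L)" using r0 by (metis zero_neq_one)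
        then show ?thesis using r0 by simp
      qed auto
    qed
  qed
  then have "(\<Sum>s\<in>B. a s * tl_rep s ?v (Domain L)) = a (\<psi> (Q_perm L))"
    using B(1) LB by (simp add: sum.delta)
  then show False
    using tl_rep_lincomb[of B a ?v "Domain L"] B QSV_image_carrier zero aL by (auto simp: tl_rep_zero)
qed

section \<open>Spanning by 321-avoiding permutations\<close>

lemma \<psi>_antisymmetrizer:
  assumes abc: "distinct [a, b, c]" "{a, b, c} \<subseteq> {1..n}" and p: "p permutes {1..n}"
  defines "s \<equiv> transpose a b" and "t \<equiv> transpose b c"
  shows "\<psi> p \<oplus>\<^bsub>T\<^esub> \<psi> (p \<circ> (s \<circ> t)) \<oplus>\<^bsub>T\<^esub> \<psi> (p \<circ> (t \<circ> s))
    = \<psi> (p \<circ> s) \<oplus>\<^bsub>T\<^esub> \<psi> (p \<circ> t) \<oplus>\<^bsub>T\<^esub> \<psi> (p \<circ> (s \<circ> t \<circ> s))"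
proof -
  \<comment> \<open>The relation for the letters 1, 2, 3 is conjugated by \<open>r\<close> and
    multiplied by \<open>p\<close> on the left.\<close>
  obtain r where r: "r permutes {1..n}" and r123: "r 1 = a" "r 2 = b" "r 3 = c"
    using permutes_exists_3[OF abc] by blast
  have "card {a, b, c} \<le> card {1..n}" using abc(2) by (intro card_mono) auto
  then have n: "3 \<le> n" using abc(1) by simp
  let ?s = "transpose 1 2 :: nat \<Rightarrow> nat" and ?t = "transpose 2 3 :: nat \<Rightarrow> nat"
  have perm: "?s permutes {1..n}" "?t permutes {1..n}"
    using n by (auto intro!: permutes_swap_id)
  note ri = permutes_inv[OF r]
  have gens: "\<psi> ?s = \<one>\<^bsub>T\<^esub> \<ominus>\<^bsub>T\<^esub> tl_gen n 2 1" "\<psi> ?t = \<one>\<^bsub>T\<^esub> \<ominus>\<^bsub>T\<^esub> tl_gen n 2 2"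
    using adjacent[of 1] adjacent[of 2] n by (auto simp: numeral_2_eq_2 numeral_3_eq_3)
  have e: "tl_gen n 2 1 \<in> carrier T" "tl_gen n 2 2 \<in> carrier T"
    using n by (auto intro!: tl_gen_carrier)
  have inv: "\<one>\<^bsub>T\<^esub> \<ominus>\<^bsub>T\<^esub> (\<one>\<^bsub>T\<^esub> \<ominus>\<^bsub>T\<^esub> x) = x" if "x \<in> carrier T" for x
    using that by (simp add: T.minus_eq T.minus_add T.r_neg2)
  have base: "\<one>\<^bsub>T\<^esub> \<oplus>\<^bsub>T\<^esub> \<psi> ?s \<otimes>\<^bsub>T\<^esub> \<psi> ?t \<oplus>\<^bsub>T\<^esub> \<psi> ?t \<otimes>\<^bsub>T\<^esub> \<psi> ?s
      = \<psi> ?s \<oplus>\<^bsub>T\<^esub> \<psi> ?t \<oplus>\<^bsub>T\<^esub> \<psi> ?s \<otimes>\<^bsub>T\<^esub> \<psi> ?t \<otimes>\<^bsub>T\<^esub> \<psi> ?s"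
  proof (rule T.antisymmetrizer_eq)
    show "\<psi> ?s \<otimes>\<^bsub>T\<^esub> \<psi> ?s = \<one>\<^bsub>T\<^esub>"
      using perm by (simp flip: \<psi>_comp add: \<psi>_id)
    show "(\<one>\<^bsub>T\<^esub> \<ominus>\<^bsub>T\<^esub> \<psi> ?s) \<otimes>\<^bsub>T\<^esub> (\<one>\<^bsub>T\<^esub> \<ominus>\<^bsub>T\<^esub> \<psi> ?t) \<otimes>\<^bsub>T\<^esub> (\<one>\<^bsub>T\<^esub> \<ominus>\<^bsub>T\<^esub> \<psi> ?s) = \<one>\<^bsub>T\<^esub> \<ominus>\<^bsub>T\<^esub> \<psi> ?s"
      unfolding gens inv[OF e(1)] inv[OF e(2)] using n by (intro tl_gen_braid) auto
  qed (use perm in auto)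
  have conj: "\<psi> (p \<circ> r) \<otimes>\<^bsub>T\<^esub> \<psi> w \<otimes>\<^bsub>T\<^esub> \<psi> (inv' r) = \<psi> (p \<circ> w')"
    if w: "w permutes {1..n}" and ww': "r \<circ> w = w' \<circ> r" for w w'
  proof -
    have "p \<circ> r \<circ> w \<circ> inv' r = p \<circ> w'"
      using ww' by (simp add: comp_assoc permutes_inv_o[OF r] flip: comp_assoc[of r w])
    then show ?thesis
      using p r ri w by (simp flip: \<psi>_comp add: permutes_compose)
  qed
  have rs: "r \<circ> ?s = s \<circ> r" "r \<circ> ?t = t \<circ> r"
    using comp_transpose[OF permutes_inj[OF r]] r123 by (auto simp: s_def t_def)
  have rst: "r \<circ> (?s \<circ> ?t) = s \<circ> t \<circ> r" "r \<circ> (?t \<circ> ?s) = t \<circ> s \<circ> r"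
    "r \<circ> (?s \<circ> ?t \<circ> ?s) = s \<circ> t \<circ> s \<circ> r"
    using rs by (metis comp_assoc)+
  have st: "?s \<circ> ?t permutes {1..n}" "?t \<circ> ?s permutes {1..n}" "?s \<circ> ?t \<circ> ?s permutes {1..n}"
    using perm by (auto intro!: permutes_compose)
  note cl = \<psi>_closed[OF permutes_compose[OF r p]] \<psi>_closed[OF ri] \<psi>_closed[OF perm(1)]
    \<psi>_closed[OF perm(2)] \<psi>_closed[OF st(1)] \<psi>_closed[OF st(2)] \<psi>_closed[OF st(3)]
  have one: "\<psi> (p \<circ> r) \<otimes>\<^bsub>T\<^esub> \<psi> (inv' r) = \<psi> p"
    using conj[OF permutes_id, of id] cl by (simp add: \<psi>_id)
  have "\<psi> (p \<circ> r) \<otimes>\<^bsub>T\<^esub> (\<one>\<^bsub>T\<^esub> \<oplus>\<^bsub>T\<^esub> \<psi> (?s \<circ> ?t) \<oplus>\<^bsub>T\<^esub> \<psi> (?t \<circ> ?s)) \<otimes>\<^bsub>T\<^esub> \<psi> (inv' r)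
      = \<psi> (p \<circ> r) \<otimes>\<^bsub>T\<^esub> (\<psi> ?s \<oplus>\<^bsub>T\<^esub> \<psi> ?t \<oplus>\<^bsub>T\<^esub> \<psi> (?s \<circ> ?t \<circ> ?s)) \<otimes>\<^bsub>T\<^esub> \<psi> (inv' r)"
    using base perm st by (simp add: \<psi>_comp)
  then have "\<psi> (p \<circ> r) \<otimes>\<^bsub>T\<^esub> \<psi> (inv' r) \<oplus>\<^bsub>T\<^esub> \<psi> (p \<circ> r) \<otimes>\<^bsub>T\<^esub> \<psi> (?s \<circ> ?t) \<otimes>\<^bsub>T\<^esub> \<psi> (inv' r)
        \<oplus>\<^bsub>T\<^esub> \<psi> (p \<circ> r) \<otimes>\<^bsub>T\<^esub> \<psi> (?t \<circ> ?s) \<otimes>\<^bsub>T\<^esub> \<psi> (inv' r)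
      = \<psi> (p \<circ> r) \<otimes>\<^bsub>T\<^esub> \<psi> ?s \<otimes>\<^bsub>T\<^esub> \<psi> (inv' r) \<oplus>\<^bsub>T\<^esub> \<psi> (p \<circ> r) \<otimes>\<^bsub>T\<^esub> \<psi> ?t \<otimes>\<^bsub>T\<^esub> \<psi> (inv' r)
        \<oplus>\<^bsub>T\<^esub> \<psi> (p \<circ> r) \<otimes>\<^bsub>T\<^esub> \<psi> (?s \<circ> ?t \<circ> ?s) \<otimes>\<^bsub>T\<^esub> \<psi> (inv' r)"
    using cl by (simp only: T.r_distr T.l_distr T.r_one T.a_closed T.m_closed T.one_closed)
  then show ?thesis
    unfolding one conj[OF perm(1) rs(1)] conj[OF perm(2) rs(2)] conj[OF st(1) rst(1)]
      conj[OF st(2) rst(2)] conj[OF st(3) rst(3)] .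
qed

lemma \<psi>_in_span_avoids_321:
  assumes "p permutes {1..n}"
  shows "\<psi> p \<in> V.span (\<psi> ` {q. avoids_321 n q})"
  using assms
proof (induction p rule: measure_induct_rule[where f = "\<lambda>p. n * (n * n) - (\<Sum>j\<in>{1..n}. j * p j)"])
  case (less p)
  let ?W = "V.span (\<psi> ` {q. avoids_321 n q})"
  let ?m = "\<lambda>p. \<Sum>j\<in>{1..n}. j * p j"
  have sub: "\<psi> ` {q. avoids_321 n q} \<subseteq> carrier T" by (auto simp: avoids_321_def)
  \<comment> \<open>This bound lets the growing sum serve as a decreasing natural number
    measure.\<close>
  have bound: "?m q \<le> n * (n * n)" if "q permutes {1..n}" for q
  proof -
    have "j * q j \<le> n * n" if "j \<in> {1..n}" for j
      using that permutes_in_image[OF \<open>q permutes {1..n}\<close>, of j] by (intro mult_le_mono) auto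
    then show ?thesis using sum_bounded_above[of "{1..n}" "\<lambda>j. j * q j" "n * n"] by simp
  qed
  have IH: "\<psi> q \<in> ?W" if "q permutes {1..n}" "?m p < ?m q" for q
    using that bound[OF that(1)] by (intro less.IH) (auto intro: diff_less_mono2)
  show ?case
  proof (cases "avoids_321 n p")
    case True
    then show ?thesis using V.in_own_span[OF sub] by blast
  next
    case False
    then obtain a b c where abc: "a \<in> {1..n}" "b \<in> {1..n}" "c \<in> {1..n}" "a < b" "b < c"
      and p: "p c < p b" "p b < p a"
      using less.prems by (auto simp: avoids_321_def)
    let ?s = "transpose a b" and ?t = "transpose b c"
    have perm: "?s permutes {1..n}" "?t permutes {1..n}" using abc by (auto intro!: permutes_swap_id)
    have swap: "?m q < ?m (q \<circ> transpose x y)"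
      if "x \<in> {1..n}" "y \<in> {1..n}" "x < y" "q y < q x" for q x y
      using that by (intro sum_mult_swap_less) auto
    have s: "?m p < ?m (p \<circ> ?s)" and t: "?m p < ?m (p \<circ> ?t)"
      by (rule swap; use abc p in auto)+
    \<comment> \<open>After the first swap, the values \<open>p a\<close> and \<open>p c\<close>
      occupy the two positions swapped next and are still inverted.\<close>
    have st: "?m (p \<circ> ?s) < ?m (p \<circ> ?s \<circ> ?t)" and ts: "?m (p \<circ> ?t) < ?m (p \<circ> ?t \<circ> ?s)"
      by (rule swap; use abc p in \<open>auto simp: transpose_def\<close>)+
    have "?s \<circ> ?t \<circ> ?s = transpose a c"
      using abc by (auto simp: fun_eq_iff transpose_def)
    moreover have "?m p < ?m (p \<circ> transpose a c)"
      using abc p by (intro swap) auto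
    ultimately have sts: "?m p < ?m (p \<circ> (?s \<circ> ?t \<circ> ?s))" by metis
    let ?y = "\<psi> (p \<circ> (?s \<circ> ?t)) \<oplus>\<^bsub>T\<^esub> \<psi> (p \<circ> (?t \<circ> ?s))"
    let ?z = "\<psi> (p \<circ> ?s) \<oplus>\<^bsub>T\<^esub> \<psi> (p \<circ> ?t) \<oplus>\<^bsub>T\<^esub> \<psi> (p \<circ> (?s \<circ> ?t \<circ> ?s))"
    have pc: "p \<circ> (?s \<circ> ?t) permutes {1..n}" "p \<circ> (?t \<circ> ?s) permutes {1..n}" "p \<circ> ?s permutes {1..n}"
      "p \<circ> ?t permutes {1..n}" "p \<circ> (?s \<circ> ?t \<circ> ?s) permutes {1..n}"
      using less.prems perm by (auto intro!: permutes_compose)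
    have W: "\<psi> (p \<circ> (?s \<circ> ?t)) \<in> ?W" "\<psi> (p \<circ> (?t \<circ> ?s)) \<in> ?W" "\<psi> (p \<circ> ?s) \<in> ?W"
      "\<psi> (p \<circ> ?t) \<in> ?W" "\<psi> (p \<circ> (?s \<circ> ?t \<circ> ?s)) \<in> ?W"
      using s t st ts sts by (auto intro!: IH pc less_trans[OF s st, unfolded comp_assoc] less_trans[OF t ts, unfolded comp_assoc])
    have "?y \<in> ?W" "?z \<in> ?W" using W by (auto intro!: V.span_add1[OF sub])
    \<comment> \<open>The relation is solved for \<open>\<psi> p\<close>: all its other terms have
      larger sums and lie in the span by induction.\<close>
    moreover have "?y \<oplus>\<^bsub>T\<^esub> \<psi> p = ?z"
      using \<psi>_antisymmetrizer[of a b c p] abc less.prems pc by (simp add: T.a_ac)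
    ultimately show ?thesis using V.span_add[OF sub, of ?y "\<psi> p"] less.prems by simp
  qed
qed

lemma \<phi>_in_span_avoids_321:
  assumes "f \<in> carrier A"
  shows "\<phi> f \<in> V.span (\<psi> ` {q. avoids_321 n q})"
proof -
  have sub: "\<psi> ` {q. avoids_321 n q} \<subseteq> carrier T" by (auto simp: avoids_321_def)
  interpret W: submodule class_ring "V.span (\<psi> ` {q. avoids_321 n q})" T
    by (rule V.span_is_submodule[OF sub])
  have "\<phi> \<zero>\<^bsub>A\<^esub> = \<zero>\<^bsub>T\<^esub>"
    using \<phi>_hom(2)[OF A.zero_closed A.zero_closed] \<phi>_hom(1)[OF A.zero_closed] by simp
  with assms show ?thesis
    by (induction rule: monoid_alg_induct)
      (auto simp: \<phi>_hom sym_group_carrier \<psi>_in_span_avoids_321)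
qed

text \<open>The image is closed under the algebra operations and contains each generator, as
  \<open>e\<^sub>i = 1 - \<psi> s\<^sub>i\<close>.\<close>

lemma \<phi>_surj:
  assumes "x \<in> carrier T"
  shows "x \<in> \<phi> ` carrier A"
proof -
  interpret F: ring "tl_free n" by (rule ring_tl_free)
  obtain f where f: "f \<in> carrier (tl_free n)" "x = tl_class n 2 f"
    using assms by (auto simp: carrier_TL)
  have one_in: "\<one>\<^bsub>T\<^esub> \<in> \<phi> ` carrier A" using \<phi>_hom(5) A.one_closed by (metis imageI)
  have add_in: "x \<oplus>\<^bsub>T\<^esub> y \<in> \<phi> ` carrier A" if "x \<in> \<phi> ` carrier A" "y \<in> \<phi> ` carrier A" for x y
    using that by (auto simp flip: \<phi>_hom(2))
  have mult_in: "x \<otimes>\<^bsub>T\<^esub> y \<in> \<phi> ` carrier A" if "x \<in> \<phi> ` carrier A" "y \<in> \<phi> ` carrier A" for x y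
    using that by (auto simp flip: \<phi>_hom(3))
  have smult_in: "c \<odot>\<^bsub>T\<^esub> x \<in> \<phi> ` carrier A" if "x \<in> \<phi> ` carrier A" for c x
    using that by (auto simp flip: \<phi>_hom(4) intro: monoid_alg_smult_closed)
  have zero_in: "\<zero>\<^bsub>T\<^esub> \<in> \<phi> ` carrier A"
    using smult_in[OF one_in, of 0] V.smult_l_null[OF T.one_closed] by simp
  have gen_in: "tl_gen n 2 i \<in> \<phi> ` carrier A" if i: "i \<in> {1..<n}" for i
  proof -
    have perm: "transpose i (i + 1) permutes {1..n}" using i by (auto intro!: permutes_swap_id)
    have "tl_gen n 2 i = \<one>\<^bsub>T\<^esub> \<ominus>\<^bsub>T\<^esub> \<psi> (transpose i (i + 1))"
      unfolding adjacent[OF i] using tl_gen_carrier[OF i] by (simp add: T.minus_eq T.minus_add T.r_neg2)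
    also have "\<dots> = \<one>\<^bsub>T\<^esub> \<oplus>\<^bsub>T\<^esub> (- 1) \<odot>\<^bsub>T\<^esub> \<psi> (transpose i (i + 1))"
      using V.smult_minus_1[OF \<psi>_closed[OF perm]] by (simp add: T.minus_eq class_ring_simps)
    finally show ?thesis using add_in[OF one_in smult_in] basis_elt_closed[OF perm] by auto
  qed
  have "tl_class n 2 (basis_elt w) \<in> \<phi> ` carrier A" if "w \<in> lists {1..<n}" for w
    using that
  proof (induction w)
    case Nil
    then show ?case
      using one_in tl_class_one[of n 2] by (simp add: tl_free_def monoid_alg_ops free_monoid_def)
  next
    case (Cons i w)
    have "basis_elt w \<in> carrier (tl_free n)"
      unfolding tl_free_def using Cons.hyps by (intro basis_elt_carrier) (simp add: free_monoid_def)
    then have "tl_gen n 2 i \<otimes>\<^bsub>T\<^esub> tl_class n 2 (basis_elt w)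
        = tl_class n 2 (basis_elt [i] \<otimes>\<^bsub>tl_free n\<^esub> basis_elt w)"
      using Cons.hyps tl_free_gen_carrier by (simp add: tl_gen_eq tl_class_hom)
    also have "basis_elt [i] \<otimes>\<^bsub>tl_free n\<^esub> basis_elt w = basis_elt (i # w)"
      by (simp add: tl_free_def basis_elt_mult free_monoid_def)
    finally show ?case using mult_in[OF gen_in[OF Cons.hyps(1)] Cons.IH] by simp
  qed
  then have basis_in: "tl_class n 2 (basis_elt w) \<in> \<phi> ` carrier A" if "w \<in> carrier (free_monoid {1..<n})" for w
    using that by (simp add: free_monoid_def)
  have class_zero: "tl_class n 2 \<zero>\<^bsub>tl_free n\<^esub> = \<zero>\<^bsub>T\<^esub>"
    using ideal_tl_ideal by (intro tl_class_ideal additive_subgroup.zero_closed) (rule ideal.axioms)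
  note free = tl_free_def[symmetric, of n]
  have "tl_class n 2 f \<in> \<phi> ` carrier A"
    using f(1)[unfolded tl_free_def]
  proof (induction rule: monoid_alg_induct)
    case zero
    show ?case unfolding free class_zero by (rule zero_in)
  next
    case (basis w)
    then show ?case by (rule basis_in)
  next
    case (add f g)
    then show ?case by (simp only: free tl_class_hom(1)[symmetric] add_in)
  next
    case (smult c f)
    then show ?case by (simp only: free tl_class_smult[symmetric] smult_in)
  qed
  then show ?thesis using f by simp
qed

text \<open>The 321-avoiding permutations bound the dimension by the number of noncrossing
  partitions, and equally many independent images \<open>\<psi> (Q_perm L)\<close> are available, so
  these form a basis.\<close>

lemma basis_QSV: "V.basis (\<phi> ` basis_elt ` QSV n)"
proof -
  let ?G = "\<psi> ` {q. avoids_321 n q}" and ?B = "\<phi> ` basis_elt ` QSV n"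
  have sub: "?G \<subseteq> carrier T" by (auto simp: avoids_321_def)
  have fin: "finite ?G" using finite_avoids_321 by simp
  have gen: "V.gen_set ?G"
    using V.span_is_subset2[OF sub] \<phi>_surj \<phi>_in_span_avoids_321 by blast
  have "V.dim \<le> card ?G" by (rule V.gen_ge_dim[OF fin sub gen])
  also have "\<dots> \<le> card {q. avoids_321 n q}" by (rule card_image_le[OF finite_avoids_321])
  also have "\<dots> \<le> card {L. noncrossing_partition n L}" by (rule card_avoids_321_le)
  also have "\<dots> = card ?B" unfolding QSV_eq by (rule card_image[OF inj_on_\<psi>_Q_perm, symmetric])
  finally have dim: "V.dim \<le> card ?B" .
  show ?thesis
  proof (rule V.dim_li_is_basis[OF _ _ QSV_image_carrier lin_indpt_QSV dim])
    show "V.fin_dim" unfolding V.fin_dim_def using fin sub gen by blast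
    show "finite ?B" unfolding QSV_eq using finite_Collect_noncrossing by simp
  qed
qed

end

theorem theorem5p1:
  fixes n :: nat
    and \<phi> :: "((nat \<Rightarrow> nat) \<Rightarrow> complex) \<Rightarrow> (nat list \<Rightarrow> complex) set"
  assumes "\<phi> \<in> alg_hom (monoid_alg (sym_group n)) (TL n 2)"
    and "\<And>i. i \<in> {1..<n} \<Longrightarrow>
      \<phi> (basis_elt (transpose i (i + 1))) = \<one>\<^bsub>TL n 2\<^esub> \<ominus>\<^bsub>TL n 2\<^esub> tl_gen n 2 i"
  shows "vectorspace.basis class_ring (TL n 2) (\<phi> ` basis_elt ` QSV n)"
proof -
  interpret tl_hom n \<phi> using assms by unfold_locales
  show ?thesis by (rule basis_QSV)
qed

end
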